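(* Let $A$ be a finite-dimensional unital commutative Frobenius algebra over a field $K$, and let $\Omega$ be an assignment of a multilinear map $\Omega(\gamma):A^{\otimes n}\to K$ to each connected cell graph $\gamma\in\Gamma_{g,n}$ (for all $g\ge0$, $n\ge1$) satisfying the edge-contraction axioms ECA 0, ECA 1 and ECA 2. Define $\Omega_{g,n}(v_1,\dots,v_n)=\Omega(\gamma)(v_1,\dots,v_n)$ for any $\gamma\in\Gamma_{g,n}$ (the value does not depend on the choice of $\gamma\in\Gamma_{g,n}$). Then $\{\Omega_{g,n}\}$ is the 2D TQFT associated with the Frobenius algebra $A$. Moreover, every 2D TQFT is obtained in this way; hence the description of 2D TQFTs by edge-contraction axioms and the description by the TQFT axioms are equivalent.
   Context: Frobenius algebra. $A$ is a finite-dimensional, unital, associative, commutative algebra over a field $K$, with multiplication $m(u,v)=uv$, unit $\mathbf 1$, and a symmetric non-degenerate bilinear form $\eta:A\otimes A\to K$ with $\eta(v_1,v_2v_3)=\eta(v_1v_2,v_3)$. The counit is $\epsilon(v)=\eta(\mathbf 1,v)$. For a basis $e_1,\dots,e_r$ of $A$ put $\eta_{ij}=\eta(e_i,e_j)$ and $[\eta^{ij}]=[\eta_{ij}]^{-1}$. The comultiplication $\delta:A\to A\otimes A$ is $\delta(v)=\sum_{i,j,a,b}\eta(v,e_ie_j)\eta^{ia}\eta^{jb}\,e_a\otimes e_b$. 2D TQFT. A 2D TQFT is a symmetric monoidal functor $Z$ from the category of oriented 2-dimensional cobordisms to finite-dimensional $K$-vector spaces; $A=Z(S^1)$ is then a commutative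 Frobenius algebra, and the TQFT gives the multilinear maps $\Omega_{g,n}=Z(\Sigma_{g,n}):A^{\otimes n}\to K$, where $\Sigma_{g,n}$ is the genus $g$ surface with $n$ boundary circles, all taken as inputs. In the form used here, the 2D TQFT associated with $A$ is a family of multilinear maps $\Omega_{g,n}:A^{\otimes n}\to K$ ($g\ge0$, $n\ge1$) with $\Omega_{0,1}(v)=\epsilon(v)$, $\Omega_{0,2}(v_1,v_2)=\eta(v_1,v_2)$, $\Omega_{0,3}(v_1,v_2,v_3)=\epsilon(v_1v_2v_3)$, satisfying the axioms of a cohomological field theory with values in $H^0(\overline{\mathcal M}_{g,n},K)=K$, namely: (0) each $\Omega_{g,n}$ is $S_n$-invariant; (1) $\Omega_{g,n+1}(v_1,\dots,v_n,\mathbf 1)=\Omega_{g,n}(v_1,\dots,v_n)$; (2) $\Omega_{g,n}(v_1,\dots,v_n)=\sum_{a,b}\Omega_{g-1,n+2}(v_1,\dots,v_n,e_a,e_b)\eta^{ab}$ for $g\ge1$; (3) $\Omega_{g_1+g_2,|I|+|J|}(v_I,v_J)=\sum_{a,b}\Omega_{g_1,|I|+1}(v_I,e_a)\,\Omega_{g_2,|J|+1}(v_J,e_b)\,\eta^{ab}$ for $I\sqcup J=\{1,\dots,n\}$. Cell graphs. A connected cell graph of type $(g,n)$ is the $1$-skeleton of a cell-decomposition of a connected compact oriented topological surface of genus $g$ with $n$ $0$-cells labeled $1,\dots,n$; $0$-cells, $1$-cells and $2$-cells are called vertices, edges and faces. Two cell graphs are identified if a(n orientation-preserving) homeomorphism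 of the surfaces carries one cell-decomposition to the other preserving vertex labels. Equivalently, a cell graph is a connected graph with labeled vertices (multiple edges and loops allowed) together with a cyclic order on the half-edges incident to each vertex; its genus is given by $n-\#\text{edges}+\#\text{faces}=2-2g$. The graph with one vertex and no edges is a cell graph of type $(0,1)$. $\Gamma_{g,n}$ is the set of connected cell graphs of type $(g,n)$. Edge-contraction operations. (i) If $E$ is an edge joining distinct vertices $i<j$, contracting $E$ merges the two vertices into one vertex labeled $i$; if the cyclic orders are $(E,a_1,\dots,a_p)$ at $i$ and $(E,b_1,\dots,b_q)$ at $j$, the cyclic order at the merged vertex is $(a_1,\dots,a_p,b_1,\dots,b_q)$. The remaining vertices keep their order. The result lies in $\Gamma_{g,n-1}$. (ii) If $L$ is a loop at vertex $i$ with half-edges $h,h'$ and the cyclic order at $i$ is $(h,a_1,\dots,a_p,h',b_1,\dots,b_q)$, contracting $L$ deletes $L$ and replaces vertex $i$ by two vertices with cyclic orders $(a_1,\dots,a_p)$ and $(b_1,\dots,b_q)$, labeled $i$ and $i'$ (in either way), with the ordering $i-1<i<i'<i+1$ of labels. The result $\gamma'$ may be disconnected. Edge-contraction axioms for the assignment $\Omega$ ($v_k\in A$ is attached to the $k$-th vertex; no permutation symmetry of $\Omega(\gamma)$ is assumed): ECA 0: for the graph $\bullet\in\Gamma_{0,1}$ with one vertex and no edges, $\Omega(\bullet)(v)=\epsilon(v)$. ECA 1: if $\gamma'\in\Gamma_{g,n-1}$ is obtained from $\gamma\in\Gamma_{g,n}$ by contracting an edge joining vertices $i<j$, then $\Omega(\gamma)(v_1,\dots,v_n)=\Omega(\gamma')(v_1,\dots,v_{i-1},v_iv_j,v_{i+1},\dots,\widehat{v_j},\dots,v_n)$,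 where $\widehat{v_j}$ means omission. ECA 2: let $\gamma'$ be obtained from $\gamma\in\Gamma_{g,n}$ by contracting a loop at vertex $i$. If $\gamma'$ is connected, then $\gamma'\in\Gamma_{g-1,n+1}$ and $\Omega(\gamma)(v_1,\dots,v_n)=\Omega(\gamma')(v_1,\dots,v_{i-1},\delta(v_i),v_{i+1},\dots,v_n)$, with $\delta(v_i)$ placed in the $i$-th and $i'$-th slots. If $\gamma'$ is disconnected, write $\gamma'=(\gamma_1,\gamma_2)\in\Gamma_{g_1,|I|+1}\times\Gamma_{g_2,|J|+1}$ with $g=g_1+g_2$ and $I\sqcup J=\{1,\dots,\widehat{i},\dots,n\}$, where $I$ (resp. $J$) labels the old vertices of $\gamma_1$ (resp. $\gamma_2$); let $(I_-,i,I_+)$ and $(J_-,i,J_+)$ be the increasing reorderings of $I\sqcup\{i\}$ and $J\sqcup\{i\}$. Then $\Omega(\gamma)(v_1,\dots,v_n)=\sum_{a,b,k,\ell}\eta(v_i,e_ke_\ell)\eta^{ka}\eta^{\ell b}\,\Omega(\gamma_1)(v_{I_-},e_a,v_{I_+})\,\Omega(\gamma_2)(v_{J_-},e_b,v_{J_+})$. *)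

theory Defs
  imports Complex_Main "HOL-Combinatorics.Combinatorics"
begin

section \<open>Cell graphs\<close>

text \<open>
  A cell graph on \<open>n\<close> labelled vertices is given by its cyclically ordered half-edges: entry \<open>k\<close> of
  \<open>rotations\<close> lists, up to cyclic rotation, the half-edges at the \<open>k\<close>-th vertex. Vertices are
  numbered from \<open>0\<close> to \<open>n - 1\<close>. Half-edges are natural numbers, and \<open>mate\<close> exchanges the two halves
  of every edge.
\<close>

record cell_graph =
  rotations :: "nat list list"
  mate :: "nat \<Rightarrow> nat"

definition num_vertices :: "cell_graph \<Rightarrow> nat" where
  "num_vertices \<gamma> = length (rotations \<gamma>)"

definition half_edges :: "cell_graph \<Rightarrow> nat set" where
  "half_edges \<gamma> = set (concat (rotations \<gamma>))"

definition wf_graph :: "cell_graph \<Rightarrow> bool" where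
  "wf_graph \<gamma> \<longleftrightarrow> distinct (concat (rotations \<gamma>)) \<and> mate \<gamma> permutes half_edges \<gamma> \<and>
     (\<forall>h\<in>half_edges \<gamma>. mate \<gamma> h \<noteq> h \<and> mate \<gamma> (mate \<gamma> h) = h)"

definition edges :: "cell_graph \<Rightarrow> nat set set" where
  "edges \<gamma> = {{h, mate \<gamma> h} | h. h \<in> half_edges \<gamma>}"

text \<open>The permutation of the half-edges sending each one to its successor at its vertex.\<close>

definition next_half_edge :: "cell_graph \<Rightarrow> nat \<Rightarrow> nat" where
  "next_half_edge \<gamma> = foldr (\<circ>) (map cycle_of_list (rotations \<gamma>)) id"

text \<open>
  The faces with nonempty boundary walk are the orbits of \<open>next_half_edge \<gamma> \<circ> mate \<gamma>\<close>. A vertex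
  without half-edges is a sphere component with exactly one face, which these orbits do not see.
\<close>

definition num_faces :: "cell_graph \<Rightarrow> nat" where
  "num_faces \<gamma> = card (orbit (next_half_edge \<gamma> \<circ> mate \<gamma>) ` half_edges \<gamma>)
     + card {k. k < num_vertices \<gamma> \<and> rotations \<gamma> ! k = []}"

definition adjacency :: "cell_graph \<Rightarrow> (nat \<times> nat) set" where
  "adjacency \<gamma> = {(i, j). i < num_vertices \<gamma> \<and> j < num_vertices \<gamma> \<and>
     (\<exists>h\<in>set (rotations \<gamma> ! i). mate \<gamma> h \<in> set (rotations \<gamma> ! j))}"

definition component_of :: "cell_graph \<Rightarrow> nat \<Rightarrow> nat set" where
  "component_of \<gamma> i = {j. j < num_vertices \<gamma> \<and> (i, j) \<in> (adjacency \<gamma>)\<^sup>*}"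

definition connected_graph :: "cell_graph \<Rightarrow> bool" where
  "connected_graph \<gamma> \<longleftrightarrow>
     (\<forall>i<num_vertices \<gamma>. \<forall>j<num_vertices \<gamma>. (i, j) \<in> (adjacency \<gamma>)\<^sup>*)"

text \<open>The connected cell graphs of type \<open>(g, n)\<close>.\<close>

definition cell_graphs :: "nat \<Rightarrow> nat \<Rightarrow> cell_graph set" where
  "cell_graphs g n = {\<gamma>. wf_graph \<gamma> \<and> connected_graph \<gamma> \<and> num_vertices \<gamma> = n \<and> n \<ge> 1 \<and>
     int n - int (card (edges \<gamma>)) + int (num_faces \<gamma>) = 2 - 2 * int g}"

definition cyclically_equal :: "'a list \<Rightarrow> 'a list \<Rightarrow> bool" where
  "cyclically_equal xs ys \<longleftrightarrow> (\<exists>m. ys = rotate m xs)"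

definition cell_graph_iso :: "cell_graph \<Rightarrow> cell_graph \<Rightarrow> bool" where
  "cell_graph_iso \<gamma> \<gamma>' \<longleftrightarrow> num_vertices \<gamma> = num_vertices \<gamma>' \<and>
     (\<exists>f. inj_on f (half_edges \<gamma>) \<and>
       (\<forall>i<num_vertices \<gamma>. cyclically_equal (map f (rotations \<gamma> ! i)) (rotations \<gamma>' ! i)) \<and>
       (\<forall>h\<in>half_edges \<gamma>. mate \<gamma>' (f h) = f (mate \<gamma> h)))"

definition point_graph :: cell_graph where
  "point_graph = \<lparr>rotations = [[]], mate = id\<rparr>"


section \<open>Edge contraction\<close>

definition remove_nth :: "nat \<Rightarrow> 'a list \<Rightarrow> 'a list" where
  "remove_nth j xs = take j xs @ drop (Suc j) xs"

definition mate_without :: "cell_graph \<Rightarrow> nat \<Rightarrow> nat \<Rightarrow> nat" where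
  "mate_without \<gamma> h = (\<lambda>x. if x = h \<or> x = mate \<gamma> h then x else mate \<gamma> x)"

definition contracts_edge :: "cell_graph \<Rightarrow> nat \<Rightarrow> nat \<Rightarrow> cell_graph \<Rightarrow> bool" where
  "contracts_edge \<gamma> i j \<gamma>' \<longleftrightarrow> i < j \<and> j < num_vertices \<gamma> \<and>
     (\<exists>h as bs. cyclically_equal (rotations \<gamma> ! i) (h # as) \<and>
        cyclically_equal (rotations \<gamma> ! j) (mate \<gamma> h # bs) \<and>
        \<gamma>' = \<lparr>rotations = remove_nth j ((rotations \<gamma>)[i := as @ bs]), mate = mate_without \<gamma> h\<rparr>)"

text \<open>
  The two new vertices take the positions \<open>i\<close> and \<open>i + 1\<close>. Since \<open>h\<close> may be either half of the
  loop, both ways of labelling them occur.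
\<close>

definition contracts_loop :: "cell_graph \<Rightarrow> nat \<Rightarrow> cell_graph \<Rightarrow> bool" where
  "contracts_loop \<gamma> i \<gamma>' \<longleftrightarrow> i < num_vertices \<gamma> \<and>
     (\<exists>h as bs. cyclically_equal (rotations \<gamma> ! i) (h # as @ mate \<gamma> h # bs) \<and>
        \<gamma>' = \<lparr>rotations = take i (rotations \<gamma>) @ [as, bs] @ drop (Suc i) (rotations \<gamma>),
              mate = mate_without \<gamma> h\<rparr>)"

text \<open>Only used when \<open>S\<close> is a connected component; the order of the vertices is kept.\<close>

definition subgraph_on :: "cell_graph \<Rightarrow> nat set \<Rightarrow> cell_graph" where
  "subgraph_on \<gamma> S =
     \<lparr>rotations = nths (rotations \<gamma>) S,
      mate = (\<lambda>x. if x \<in> set (concat (nths (rotations \<gamma>) S)) then mate \<gamma> x else x)\<rparr>"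


section \<open>Frobenius algebras\<close>

text \<open>
  The sort is that of commutative rings with unit in which \<open>0 = 1\<close> is not excluded. The other half
  of bilinearity of \<open>\<eta>\<close> follows by symmetry.
\<close>

locale frobenius_algebra = finite_dimensional_vector_space scale Basis
  for scale :: "'k::field \<Rightarrow> 'a::{comm_ring, comm_monoid_mult} \<Rightarrow> 'a"
  and Basis :: "'a set" +
  fixes \<eta> :: "'a \<Rightarrow> 'a \<Rightarrow> 'k"
  assumes scale_mult: "scale c (u * v) = scale c u * v"
    and eta_linear: "Vector_Spaces.linear scale (*) (\<eta> u)"
    and eta_sym: "\<eta> u v = \<eta> v u"
    and eta_nondegenerate: "(\<And>v. \<eta> u v = 0) \<Longrightarrow> u = 0"
    and eta_mult: "\<eta> v1 (v2 * v3) = \<eta> (v1 * v2) v3"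
begin

definition counit :: "'a \<Rightarrow> 'k" where
  "counit v = \<eta> 1 v"

text \<open>
  The inverse matrix \<open>\<eta>\<^sup>a\<^sup>b\<close> of the Gram matrix, indexed by \<open>Basis\<close>; only its values on
  \<open>Basis \<times> Basis\<close> are determined.
\<close>

definition eta_inv :: "'a \<Rightarrow> 'a \<Rightarrow> 'k" where
  "eta_inv = (SOME E. \<forall>i\<in>Basis. \<forall>k\<in>Basis.
     (\<Sum>j\<in>Basis. \<eta> i j * E j k) = (if i = k then 1 else 0) \<and>
     (\<Sum>j\<in>Basis. E i j * \<eta> j k) = (if i = k then 1 else 0))"

text \<open>The coefficient of \<open>a \<otimes> b\<close> in \<open>\<delta>(v)\<close>, for basis vectors \<open>a\<close> and \<open>b\<close>.\<close>

definition comult_coeff :: "'a \<Rightarrow> 'a \<Rightarrow> 'a \<Rightarrow> 'k" where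
  "comult_coeff v a b = (\<Sum>k\<in>Basis. \<Sum>l\<in>Basis. \<eta> v (k * l) * eta_inv k a * eta_inv l b)"

text \<open>The value on \<open>\<delta>(v)\<close> of the linear form on \<open>A \<otimes> A\<close> given by a bilinear map \<open>f\<close>.\<close>

definition on_comult :: "'a \<Rightarrow> ('a \<Rightarrow> 'a \<Rightarrow> 'k) \<Rightarrow> 'k" where
  "on_comult v f = (\<Sum>a\<in>Basis. \<Sum>b\<in>Basis. comult_coeff v a b * f a b)"

text \<open>Functions of \<open>n\<close> vectors are functions on lists, of which only the lists of length \<open>n\<close> matter.\<close>

definition multilinear :: "nat \<Rightarrow> ('a list \<Rightarrow> 'k) \<Rightarrow> bool" where
  "multilinear n f \<longleftrightarrow>
     (\<forall>vs i. length vs = n \<longrightarrow> i < n \<longrightarrow> Vector_Spaces.linear scale (*) (\<lambda>x. f (vs[i := x])))"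


subsection \<open>The TQFT axioms\<close>

definition is_TQFT :: "(nat \<Rightarrow> nat \<Rightarrow> 'a list \<Rightarrow> 'k) \<Rightarrow> bool" where
  "is_TQFT \<omega> \<longleftrightarrow>
     (\<forall>g n. n \<ge> 1 \<longrightarrow> multilinear n (\<omega> g n)) \<and>
     (\<forall>v. \<omega> 0 1 [v] = counit v) \<and>
     (\<forall>v1 v2. \<omega> 0 2 [v1, v2] = \<eta> v1 v2) \<and>
     (\<forall>v1 v2 v3. \<omega> 0 3 [v1, v2, v3] = counit (v1 * v2 * v3)) \<and>
     (\<forall>g n p vs. n \<ge> 1 \<longrightarrow> length vs = n \<longrightarrow> p permutes {..<n} \<longrightarrow>
        \<omega> g n (permute_list p vs) = \<omega> g n vs) \<and>
     (\<forall>g n vs. n \<ge> 1 \<longrightarrow> length vs = n \<longrightarrow> \<omega> g (n + 1) (vs @ [1]) = \<omega> g n vs) \<and>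
     (\<forall>g n vs. g \<ge> 1 \<longrightarrow> n \<ge> 1 \<longrightarrow> length vs = n \<longrightarrow>
        \<omega> g n vs = (\<Sum>a\<in>Basis. \<Sum>b\<in>Basis. \<omega> (g - 1) (n + 2) (vs @ [a, b]) * eta_inv a b)) \<and>
     (\<forall>g1 g2 us ws. length us + length ws \<ge> 1 \<longrightarrow>
        \<omega> (g1 + g2) (length us + length ws) (us @ ws) =
          (\<Sum>a\<in>Basis. \<Sum>b\<in>Basis.
             \<omega> g1 (length us + 1) (us @ [a]) * \<omega> g2 (length ws + 1) (ws @ [b]) * eta_inv a b))"


subsection \<open>The edge-contraction axioms\<close>

text \<open>A multilinear map for every connected cell graph, depending only on its isomorphism class.\<close>

definition graph_assignment :: "(cell_graph \<Rightarrow> 'a list \<Rightarrow> 'k) \<Rightarrow> bool" where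
  "graph_assignment \<Omega> \<longleftrightarrow>
     (\<forall>g n. \<forall>\<gamma>\<in>cell_graphs g n. multilinear n (\<Omega> \<gamma>)) \<and>
     (\<forall>g n. \<forall>\<gamma>\<in>cell_graphs g n. \<forall>\<gamma>'\<in>cell_graphs g n. cell_graph_iso \<gamma> \<gamma>' \<longrightarrow>
        (\<forall>vs. length vs = n \<longrightarrow> \<Omega> \<gamma> vs = \<Omega> \<gamma>' vs))"

definition ECA0 :: "(cell_graph \<Rightarrow> 'a list \<Rightarrow> 'k) \<Rightarrow> bool" where
  "ECA0 \<Omega> \<longleftrightarrow> (\<forall>v. \<Omega> point_graph [v] = counit v)"

definition ECA1 :: "(cell_graph \<Rightarrow> 'a list \<Rightarrow> 'k) \<Rightarrow> bool" where
  "ECA1 \<Omega> \<longleftrightarrow>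
     (\<forall>g n. \<forall>\<gamma>\<in>cell_graphs g n. \<forall>i j \<gamma>' vs. contracts_edge \<gamma> i j \<gamma>' \<longrightarrow> length vs = n \<longrightarrow>
        \<Omega> \<gamma> vs = \<Omega> \<gamma>' (remove_nth j (vs[i := vs ! i * vs ! j])))"

definition split_slot :: "nat \<Rightarrow> 'a list \<Rightarrow> 'a \<Rightarrow> 'a \<Rightarrow> 'a list" where
  "split_slot i vs a b = take i vs @ [a, b] @ drop (Suc i) vs"

text \<open>
  In the disconnected case the components are those of the new vertices \<open>i\<close> and \<open>i + 1\<close>, and
  selecting the entries of \<open>split_slot i vs a b\<close> at the vertices of a component gives the argument
  lists \<open>(v\<^bsub>I-\<^esub>, a, v\<^bsub>I+\<^esub>)\<close> and \<open>(v\<^bsub>J-\<^esub>, b, v\<^bsub>J+\<^esub>)\<close>.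
\<close>

definition ECA2 :: "(cell_graph \<Rightarrow> 'a list \<Rightarrow> 'k) \<Rightarrow> bool" where
  "ECA2 \<Omega> \<longleftrightarrow>
     (\<forall>g n. \<forall>\<gamma>\<in>cell_graphs g n. \<forall>i \<gamma>' vs. contracts_loop \<gamma> i \<gamma>' \<longrightarrow> length vs = n \<longrightarrow>
        (connected_graph \<gamma>' \<longrightarrow>
           \<Omega> \<gamma> vs = on_comult (vs ! i) (\<lambda>a b. \<Omega> \<gamma>' (split_slot i vs a b))) \<and>
        (\<not> connected_graph \<gamma>' \<longrightarrow>
           (let S1 = component_of \<gamma>' i; S2 = component_of \<gamma>' (i + 1) in
            \<Omega> \<gamma> vs = on_comult (vs ! i) (\<lambda>a b.
              \<Omega> (subgraph_on \<gamma>' S1) (nths (split_slot i vs a b) S1) *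
              \<Omega> (subgraph_on \<gamma>' S2) (nths (split_slot i vs a b) S2)))))"

definition satisfies_ECA :: "(cell_graph \<Rightarrow> 'a list \<Rightarrow> 'k) \<Rightarrow> bool" where
  "satisfies_ECA \<Omega> \<longleftrightarrow> graph_assignment \<Omega> \<and> ECA0 \<Omega> \<and> ECA1 \<Omega> \<and> ECA2 \<Omega>"

end

text \<open>The family read off from an arbitrary representative of each type \<open>(g, n)\<close>.\<close>

definition induced_family ::
    "(cell_graph \<Rightarrow> 'a list \<Rightarrow> 'k) \<Rightarrow> nat \<Rightarrow> nat \<Rightarrow> 'a list \<Rightarrow> 'k" where
  "induced_family \<Omega> g n = \<Omega> (SOME \<gamma>. \<gamma> \<in> cell_graphs g n)"

end

theory Submission
  imports Defs
begin

text \<open>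
  With the Euler element \<open>e = \<Sum>\<^sub>k e\<^sub>k e\<^sup>k\<close>, where \<open>e\<^sup>k\<close> is the \<open>\<eta>\<close>-dual basis, both descriptions
  force the value \<open>\<epsilon>(v\<^sub>1 \<cdots> v\<^sub>n e\<^sup>g)\<close> in type \<open>(g, n)\<close>. For cell graphs this is an induction on the number of
  edges. Contracting an edge preserves the faces, because the face permutation of the contracted
  graph is the first return map of the old one, and a face that is lost reappears as a vertex without
  half-edges. So contracting a loop raises the Euler characteristic by 2; this lowers the genus by
  one if the graph stays connected and splits it as \<open>g = g\<^sub>1 + g\<^sub>2\<close> otherwise, while \<open>m \<circ> \<delta>\<close> is
  multiplication by \<open>e\<close>, and \<open>\<delta>\<close> is dual to \<open>m\<close>. The same induction shows that the genus of a
  connected graph is a natural number.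
\<close>

section \<open>Orbits of a bypassed permutation\<close>

text \<open>Neither axiom system is derived from the other: each forces the same closed formula, so
  permutation invariance and independence of the chosen graph come from commutativity of
  \<open>A\<close> instead of from moves between graphs. The element \<open>e\<close> is the value
  of \<open>m \<circ> \<delta>\<close> at the unit, that is, one handle.

  The combinatorial obstacle is that a type is fixed by an integer Euler characteristic. After a
  contraction nothing says yet that the new graph, or each of two components separately, has Euler
  characteristic 2 - 2g with g a natural number, and the induction hypothesis, which speaks of
  \<open>cell_graphs\<close>, applies only then. Hence the genus is settled before any algebra. No
  topology enters, only the count of orbits of a permutation after a point is cut out of its cycle.

  Since \<open>induced_family\<close> picks a representative by \<open>SOME\<close>, the formula
  transfers to it only because every type with n \<ge> 1 contains a graph, which calls for an
  explicit construction.\<close>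

text \<open>Composing with the transposition cuts \<open>x\<close> out of its cycle: the predecessor
  of \<open>x\<close> now goes straight to \<open>f x\<close>, and \<open>x\<close> becomes a fixed
  point. By injectivity \<open>f y = f x\<close> only for \<open>y = x\<close>, so no other value
  changes.\<close>

lemma bypass_apply:
  assumes "f permutes S"
  shows "(transpose x (f x) \<circ> f) y = (if y = x then x else if f y = x then f x else f y)"
  using permutes_inj[OF assms] by (auto simp: transpose_def dest: injD)

lemma bypass_permutes:
  assumes "f permutes S" "x \<in> S"
  shows "(transpose x (f x) \<circ> f) permutes (S - {x})"
proof (rule permutes_superset)
  show "(transpose x (f x) \<circ> f) permutes S"
    using assms by (intro permutes_compose permutes_swap_id) (simp_all add: permutes_in_image)
qed auto

text \<open>If \<open>x\<close> is a fixed point, its singleton orbit is the one lost. Otherwise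
  every orbit of \<open>f'\<close> is an orbit of \<open>f\<close> with \<open>x\<close> deleted;
  all orbits are still met, because \<open>f x\<close> represents the one through \<open>x\<close>,
  and deleting \<open>x\<close> keeps distinct orbits distinct, because orbits that share a point
  coincide.\<close>

lemma card_orbits_bypass:
  assumes f: "f permutes S" and S: "finite S" and x: "x \<in> S"
  defines "f' \<equiv> transpose x (f x) \<circ> f"
  shows "card (orbit f ` S) = card (orbit f' ` (S - {x})) + (if f x = x then 1 else 0)"
proof -
  have perm: "permutation f" using f S by (auto simp: permutation_permutes)
  note self = permutation_self_in_orbit[OF perm]
  have f': "f' y = (if y = x then x else if f y = x then f x else f y)" for y
    unfolding f'_def by (rule bypass_apply[OF f])
  show ?thesis
  proof (cases "f x = x")
    case True
    then have "f' = f" by (simp add: f'_def)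
    have "orbit f x \<notin> orbit f ` (S - {x})"
      using self True orbit_eq_singleton_iff[of f x] by fastforce
    moreover have "orbit f ` S = insert (orbit f x) (orbit f ` (S - {x}))" using x by blast
    ultimately show ?thesis using S True \<open>f' = f\<close> by simp
  next
    case False
    have orbit': "orbit f' y = orbit f y - {x}" if "y \<noteq> x" for y
    proof (intro set_eqI iffI)
      fix z assume "z \<in> orbit f' y"
      then show "z \<in> orbit f y - {x}"
      proof induction
        case base
        then show ?case using that False by (auto simp: f' intro: orbit.intros orbit.step[of x])
      next
        case (step z)
        then show ?case using False by (auto simp: f' intro: orbit.intros)
      qed
    next
      \<comment> \<open>The second conjunct carries the induction through \<open>x\<close>, which
        \<open>f'\<close> skips: when the old orbit arrives at \<open>x\<close>, the new one is
        already at \<open>f x\<close>.\<close>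
      have "(z \<noteq> x \<longrightarrow> z \<in> orbit f' y) \<and> (z = x \<longrightarrow> f x \<in> orbit f' y)" if "z \<in> orbit f y" for z
        using that
      proof induction
        case base
        then show ?case using \<open>y \<noteq> x\<close> False orbit.base[of f' y] f'[of y] by (cases "f y = x") simp_all
      next
        case (step z)
        then show ?case using False orbit.step[of z f' y] f'[of z] by (cases "z = x"; cases "f z = x") simp_all
      qed
      then show "z \<in> orbit f' y" if "z \<in> orbit f y - {x}" for z using that by blast
    qed
    have "orbit f x = orbit f (f x)" by (rule permutation_orbit_step[OF perm, symmetric])
    moreover have "f x \<in> S - {x}" using x f False by (simp add: permutes_in_image)
    ultimately have "orbit f ` S = orbit f ` (S - {x})" using x by blast
    moreover have "orbit f' ` (S - {x}) = (\<lambda>Q. Q - {x}) ` orbit f ` (S - {x})"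
      by (auto simp: orbit' image_image)
    moreover have "inj_on (\<lambda>Q. Q - {x}) (orbit f ` (S - {x}))"
    proof (rule inj_onI)
      fix Q R assume "Q \<in> orbit f ` (S - {x})" "R \<in> orbit f ` (S - {x})" and eq: "Q - {x} = R - {x}"
      then obtain y z where "Q = orbit f y" "R = orbit f z" "y \<noteq> x" by auto
      with eq self[of y] have "y \<in> orbit f z" by blast
      then show "Q = R"
        using \<open>Q = _\<close> \<open>R = _\<close> cyclic_on_orbit'[OF perm] orbit_cyclic_eq3 by metis
    qed
    ultimately show ?thesis using False by (simp add: card_image)
  qed
qed

lemma involution_permutes:
  assumes "\<And>x. x \<notin> S \<Longrightarrow> p x = x" "\<And>x. x \<in> S \<Longrightarrow> p x \<in> S" "\<And>x. x \<in> S \<Longrightarrow> p (p x) = x"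
  shows "p permutes S"
proof -
  have "p (p x) = x" for x using assms by (cases "x \<in> S") auto
  then show ?thesis unfolding permutes_def using assms(1) by metis
qed

section \<open>Faces under edge removal\<close>

text \<open>One expression covers three cases: the next entry of the list, the first entry when
  \<open>x\<close> is last, and \<open>x\<close> itself when the list has no other entry. The last
  case is the fixed point that a leaf of the graph produces.\<close>

lemma cycle_of_list_successor:
  assumes "distinct (us @ x # vs)"
  shows "cycle_of_list (us @ x # vs) x = hd (vs @ us @ [x])"
proof -
  let ?cs = "us @ x # vs"
  have "map (cycle_of_list ?cs) ?cs = rotate1 ?cs"
    using cyclic_rotation[OF assms, of 1] by simp
  from arg_cong[OF this, of "\<lambda>l. l ! length us"]
  have "cycle_of_list ?cs x = rotate1 ?cs ! length us" by (simp add: nth_append)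
  also have "\<dots> = hd (vs @ us @ [x])"
    by (cases us; cases vs) (simp_all add: nth_append)
  finally show ?thesis .
qed

lemma next_outside:
  "x \<notin> set (concat rs) \<Longrightarrow> foldr (\<circ>) (map cycle_of_list rs) id x = x"
  by (induction rs) (simp_all add: id_outside_supp)

text \<open>The cycles have disjoint supports: the factors applied before that of \<open>r\<close>
  fix \<open>x\<close>, and those applied after it fix its image, which again lies in
  \<open>r\<close>.\<close>

lemma next_inside:
  assumes "distinct (concat rs)" "r \<in> set rs" "x \<in> set r"
  shows "foldr (\<circ>) (map cycle_of_list rs) id x = cycle_of_list r x"
  using assms
proof (induction rs)
  case (Cons s rs)
  have eq: "foldr (\<circ>) (map cycle_of_list (s # rs)) id x =
      cycle_of_list s (foldr (\<circ>) (map cycle_of_list rs) id x)" by simp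
  show ?case
  proof (cases "x \<in> set s")
    case True
    with Cons.prems have "x \<notin> set (concat rs)" by auto
    then have "foldr (\<circ>) (map cycle_of_list rs) id x = x" by (rule next_outside)
    moreover have "r = s" using Cons.prems True by auto
    ultimately show ?thesis by (simp only: eq)
  next
    case False
    with Cons.prems have r: "r \<in> set rs" by auto
    have "cycle_of_list r x \<in> set r"
      using cycle_permutes[of r] Cons.prems(3) by (simp add: permutes_in_image)
    with r Cons.prems have "cycle_of_list r x \<notin> set s" by auto
    moreover have "foldr (\<circ>) (map cycle_of_list rs) id x = cycle_of_list r x"
      using Cons.prems r by (intro Cons.IH) auto
    ultimately show ?thesis by (metis eq id_outside_supp)
  qed
qed simp

lemma next_half_edge_permutes: "next_half_edge \<gamma> permutes half_edges \<gamma>"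
proof -
  have "foldr (\<circ>) (map cycle_of_list rs) id permutes set (concat rs)" for rs :: "nat list list"
  proof (induction rs)
    case (Cons r rs)
    have "cycle_of_list r permutes set (concat (r # rs))"
      by (rule permutes_subset[OF cycle_permutes]) simp
    moreover have "foldr (\<circ>) (map cycle_of_list rs) id permutes set (concat (r # rs))"
      by (rule permutes_subset[OF Cons.IH]) simp
    moreover have "foldr (\<circ>) (map cycle_of_list (r # rs)) id =
        cycle_of_list r \<circ> foldr (\<circ>) (map cycle_of_list rs) id" by simp
    ultimately show ?case by (metis permutes_compose)
  qed (simp add: fun_eq_iff)
  then show ?thesis by (simp add: next_half_edge_def half_edges_def)
qed

lemma next_half_edge_eq_cycle:
  assumes "distinct (concat (rotations \<gamma>))" "r \<in> set (rotations \<gamma>)" "x \<in> set r"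
  shows "next_half_edge \<gamma> x = cycle_of_list r x"
  unfolding next_half_edge_def using assms by (rule next_inside)

lemma mset_cyclically_equal:
  assumes "cyclically_equal xs ys"
  shows "mset ys = mset xs"
proof -
  obtain m where "ys = rotate m xs" using assms by (auto simp: cyclically_equal_def)
  then have "mset ys = mset (take (m mod length xs) xs @ drop (m mod length xs) xs)"
    by (simp add: rotate_drop_take add.commute del: append_take_drop_id)
  then show ?thesis by simp
qed

lemma set_cyclically_equal: "cyclically_equal xs ys \<Longrightarrow> set ys = set xs"
  by (auto simp: cyclically_equal_def)

text \<open>A contraction presents a vertex by a conveniently rotated list, while
  \<open>next_half_edge\<close> is built from the stored one. A cycle does not see where its list
  begins, so the successor can be read off any presentation.\<close>

lemma next_half_edge_eq:
  assumes "distinct (concat (rotations \<gamma>))" "r \<in> set (rotations \<gamma>)" "cyclically_equal r (us @ x # vs)"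
  shows "next_half_edge \<gamma> x = hd (vs @ us @ [x])"
proof -
  have r: "distinct r" using assms(1,2) by (auto simp: distinct_concat_iff)
  obtain m where m: "us @ x # vs = rotate m r" using assms(3) by (auto simp: cyclically_equal_def)
  have "x \<in> set r" using set_cyclically_equal[OF assms(3)] by auto
  then have "next_half_edge \<gamma> x = cycle_of_list r x"
    by (rule next_half_edge_eq_cycle[OF assms(1,2)])
  also have "\<dots> = cycle_of_list (us @ x # vs) x"
    unfolding m using cycle_of_list_rotate_independent[OF r] by simp
  also have "\<dots> = hd (vs @ us @ [x])"
    using r by (intro cycle_of_list_successor) (simp add: m del: distinct_append)
  finally show ?thesis .
qed

definition face_perm :: "cell_graph \<Rightarrow> nat \<Rightarrow> nat" where
  "face_perm \<gamma> = next_half_edge \<gamma> \<circ> mate \<gamma>"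

lemma face_perm_permutes: "wf_graph \<gamma> \<Longrightarrow> face_perm \<gamma> permutes half_edges \<gamma>"
  unfolding face_perm_def by (intro permutes_compose next_half_edge_permutes) (simp add: wf_graph_def)

lemma finite_half_edges [simp]: "finite (half_edges \<gamma>)"
  by (simp add: half_edges_def)

text \<open>In this list form the second summand is additive under concatenation, so replacing
  single entries of \<open>rotations\<close> changes it visibly.\<close>

lemma num_faces_alt:
  "num_faces \<gamma> = card (orbit (face_perm \<gamma>) ` half_edges \<gamma>) +
     length (filter (\<lambda>r. r = []) (rotations \<gamma>))"
  by (simp add: num_faces_def face_perm_def length_filter_conv_card num_vertices_def)

lemma edges_alt: "edges \<gamma> = (\<lambda>x. {x, mate \<gamma> x}) ` half_edges \<gamma>"
  by (auto simp: edges_def)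

text \<open>
  The assumption \<open>next'\<close> describes both kinds of contraction at once: it makes the face permutation of
  \<open>\<gamma>'\<close> the first return map of the face permutation of \<open>\<gamma>\<close> to the remaining half-edges.
\<close>

locale edge_removal =
  fixes \<gamma> \<gamma>' :: cell_graph and h :: nat
  assumes wf: "wf_graph \<gamma>" and h: "h \<in> half_edges \<gamma>"
    and distinct': "distinct (concat (rotations \<gamma>'))"
    and half_edges': "half_edges \<gamma>' = half_edges \<gamma> - {h, mate \<gamma> h}"
    and mate': "mate \<gamma>' = mate_without \<gamma> h"
    and next': "\<And>x. x \<in> half_edges \<gamma>' \<Longrightarrow> next_half_edge \<gamma>' x =
      (if next_half_edge \<gamma> x = h then
         (if next_half_edge \<gamma> (mate \<gamma> h) = mate \<gamma> h
          then next_half_edge \<gamma> h else next_half_edge \<gamma> (mate \<gamma> h))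
       else if next_half_edge \<gamma> x = mate \<gamma> h then
         (if next_half_edge \<gamma> h = h then next_half_edge \<gamma> (mate \<gamma> h) else next_half_edge \<gamma> h)
       else next_half_edge \<gamma> x)"
begin

lemma mate_h: "mate \<gamma> h \<in> half_edges \<gamma>" "mate \<gamma> h \<noteq> h" "mate \<gamma> (mate \<gamma> h) = h"
  using wf h by (auto simp: wf_graph_def permutes_in_image)

lemma mate_in:
  assumes "x \<in> half_edges \<gamma>'"
  shows "mate \<gamma> x \<in> half_edges \<gamma>'" "mate \<gamma>' x = mate \<gamma> x"
proof -
  have x: "x \<in> half_edges \<gamma>" "x \<noteq> h" "x \<noteq> mate \<gamma> h" using assms half_edges' by auto
  then show "mate \<gamma>' x = mate \<gamma> x" by (simp add: mate' mate_without_def)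
  have inv: "mate \<gamma> x \<in> half_edges \<gamma>" "mate \<gamma> (mate \<gamma> x) = x"
    using wf x(1) by (simp_all add: wf_graph_def permutes_in_image)
  have "mate \<gamma> x \<noteq> h" "mate \<gamma> x \<noteq> mate \<gamma> h" using inv(2) mate_h(3) x by metis+
  with inv(1) show "mate \<gamma> x \<in> half_edges \<gamma>'" by (simp add: half_edges')
qed

lemma wf': "wf_graph \<gamma>'"
proof -
  have inv: "mate \<gamma>' x \<noteq> x \<and> mate \<gamma>' (mate \<gamma>' x) = x" if "x \<in> half_edges \<gamma>'" for x
    using that mate_in[of x] mate_in[of "mate \<gamma> x"] wf half_edges' by (auto simp: wf_graph_def)
  have "mate \<gamma>' permutes half_edges \<gamma>'"
  proof (rule involution_permutes)
    fix x assume "x \<notin> half_edges \<gamma>'"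
    then have "x \<notin> half_edges \<gamma> \<or> x = h \<or> x = mate \<gamma> h" using half_edges' by auto
    then show "mate \<gamma>' x = x"
      using wf by (auto simp: mate' mate_without_def wf_graph_def permutes_not_in)
  qed (use inv mate_in in auto)
  with inv distinct' show ?thesis by (simp add: wf_graph_def)
qed

lemma card_half_edges_less: "card (half_edges \<gamma>') < card (half_edges \<gamma>)"
  using h half_edges' by (intro psubset_card_mono) auto

lemma card_edges: "card (edges \<gamma>) = Suc (card (edges \<gamma>'))"
proof -
  have "edges \<gamma> = insert {h, mate \<gamma> h} (edges \<gamma>')"
  proof (intro set_eqI iffI)
    fix e assume "e \<in> edges \<gamma>"
    then obtain x where x: "x \<in> half_edges \<gamma>" "e = {x, mate \<gamma> x}" by (auto simp: edges_def)
    show "e \<in> insert {h, mate \<gamma> h} (edges \<gamma>')"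
    proof (cases "x \<in> half_edges \<gamma>'")
      case True
      with x mate_in(2)[OF True] show ?thesis by (auto simp: edges_def)
    next
      case False
      with x have "x = h \<or> x = mate \<gamma> h" using half_edges' by auto
      with x mate_h show ?thesis by auto
    qed
  next
    fix e assume "e \<in> insert {h, mate \<gamma> h} (edges \<gamma>')"
    then show "e \<in> edges \<gamma>" using h mate_in(2) half_edges' by (auto simp: edges_def)
  qed
  moreover have "{h, mate \<gamma> h} \<notin> edges \<gamma>'"
  proof
    assume "{h, mate \<gamma> h} \<in> edges \<gamma>'"
    then obtain x where x: "x \<in> half_edges \<gamma>'" and "{h, mate \<gamma> h} = {x, mate \<gamma>' x}"
      unfolding edges_def by blast
    then have "h = x \<or> h = mate \<gamma> x" using mate_in(2)[OF x] by blast
    then show False using x mate_in(1)[OF x] half_edges' by auto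
  qed
  moreover have "finite (edges \<gamma>')" by (simp add: edges_alt)
  ultimately show ?thesis by simp
qed

text \<open>The points \<open>h\<close> and \<open>mate \<gamma> h\<close> are bypassed one after
  the other. The two correction terms count the face orbits contained in
  \<open>{h, mate \<gamma> h}\<close>, which vanish with the edge: the singleton of \<open>h\<close>
  in the first term, the singleton of \<open>mate \<gamma> h\<close> or the pair as one 2-cycle in
  the second.\<close>

lemma card_face_orbits:
  "card (orbit (face_perm \<gamma>) ` half_edges \<gamma>) =
     card (orbit (face_perm \<gamma>') ` half_edges \<gamma>') +
     (if next_half_edge \<gamma> (mate \<gamma> h) = h then 1 else 0) +
     (if next_half_edge \<gamma> h = mate \<gamma> h \<or>
        next_half_edge \<gamma> h = h \<and> next_half_edge \<gamma> (mate \<gamma> h) = mate \<gamma> h then 1 else 0)"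
proof -
  let ?h' = "mate \<gamma> h" and ?s = "next_half_edge \<gamma>" and ?f = "face_perm \<gamma>"
  define f1 where "f1 = transpose h (?f h) \<circ> ?f"
  define f2 where "f2 = transpose ?h' (f1 ?h') \<circ> f1"
  have f: "?f permutes half_edges \<gamma>" by (rule face_perm_permutes[OF wf])
  have f1: "f1 permutes (half_edges \<gamma> - {h})"
    unfolding f1_def by (rule bypass_permutes[OF f h])
  have h': "?h' \<in> half_edges \<gamma> - {h}" using mate_h by simp
  have H: "half_edges \<gamma> - {h} - {?h'} = half_edges \<gamma>'" using half_edges' by auto
  have fh: "?f h = ?s ?h'" "?f ?h' = ?s h" by (simp_all add: face_perm_def mate_h)
  have f1_eq: "f1 y = (if y = h then h else if ?f y = h then ?f h else ?f y)" for y
    unfolding f1_def by (rule bypass_apply[OF f])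
  have f2_eq: "f2 y = (if y = ?h' then ?h' else if f1 y = ?h' then f1 ?h' else f1 y)" for y
    unfolding f2_def by (rule bypass_apply[OF f1])
  have f1h': "f1 ?h' = (if ?s h = h then ?s ?h' else ?s h)" using mate_h by (simp add: f1_eq fh)
  have inj: "inj ?s" by (rule permutes_inj[OF next_half_edge_permutes])
  have agree: "f2 y = face_perm \<gamma>' y" if y: "y \<in> half_edges \<gamma>'" for y
  proof -
    let ?z = "mate \<gamma> y"
    have z: "?z \<in> half_edges \<gamma>'" "?z \<noteq> h" "?z \<noteq> ?h'" and fy: "face_perm \<gamma>' y = next_half_edge \<gamma>' ?z"
      using mate_in[OF y] half_edges' by (auto simp: face_perm_def)
    have yh: "y \<noteq> h" "y \<noteq> ?h'" using y half_edges' by auto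
    \<comment> \<open>A value taken at \<open>?z\<close> is not taken at \<open>h\<close> or
      \<open>?h'\<close> as well. This rules out the coincidences in which the nested cases of
      \<open>f2\<close> would differ from \<open>next'\<close>.\<close>
    have "?s ?z = h \<Longrightarrow> ?s h \<noteq> h" "?s ?z = h \<Longrightarrow> ?s ?h' \<noteq> h" "?s ?z = ?h' \<Longrightarrow> ?s h \<noteq> ?h'"
      using z(2,3) by (metis injD[OF inj])+
    then show ?thesis
      unfolding fy next'[OF z(1)] f2_eq f1h' using yh mate_h(2)
      by (simp add: f1_eq fh face_perm_def)
  qed
  have orbit_eq: "orbit f2 y = orbit (face_perm \<gamma>') y" if "y \<in> half_edges \<gamma>'" for y
  proof (rule orbit_cong0[OF that _ agree])
    have "f2 permutes half_edges \<gamma>'" unfolding f2_def H[symmetric] by (rule bypass_permutes[OF f1 h'])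
    then show "f2 \<in> half_edges \<gamma>' \<rightarrow> half_edges \<gamma>'" by (auto simp: permutes_in_image)
  qed
  then have orbits: "orbit f2 ` half_edges \<gamma>' = orbit (face_perm \<gamma>') ` half_edges \<gamma>'"
    by (intro image_cong) simp_all
  have "card (orbit ?f ` half_edges \<gamma>) =
      card (orbit f1 ` (half_edges \<gamma> - {h})) + (if ?f h = h then 1 else 0)"
    unfolding f1_def by (rule card_orbits_bypass[OF f _ h]) simp
  also have "card (orbit f1 ` (half_edges \<gamma> - {h})) =
      card (orbit f2 ` (half_edges \<gamma> - {h} - {?h'})) + (if f1 ?h' = ?h' then 1 else 0)"
    unfolding f2_def by (rule card_orbits_bypass[OF f1 _ h']) simp
  also have "(f1 ?h' = ?h') = (?s h = ?h' \<or> ?s h = h \<and> ?s ?h' = ?h')"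
    using mate_h(2) by (auto simp: f1h')
  finally show ?thesis unfolding H orbits fh by simp
qed

end

section \<open>Both kinds of contraction are edge removals that preserve the number of faces\<close>

lemma distinct_concat_remove_two:
  assumes "distinct (concat rs)" "mset (concat rs) = mset (x # y # concat rs')"
  shows "distinct (x # y # concat rs')" "set (concat rs) = insert x (insert y (set (concat rs')))"
proof -
  show "distinct (x # y # concat rs')"
    using assms mset_eq_imp_distinct_iff by blast
  show "set (concat rs) = insert x (insert y (set (concat rs')))"
    using mset_eq_setD[OF assms(2)] by simp
qed

lemma next_unaffected:
  assumes "wf_graph \<gamma>" "distinct (concat (rotations \<gamma>'))" "r \<in> set (rotations \<gamma>)" "r \<in> set (rotations \<gamma>')" "x \<in> set r"
  shows "next_half_edge \<gamma>' x = next_half_edge \<gamma> x" "next_half_edge \<gamma> x \<in> set r"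
proof -
  have eq: "next_half_edge \<gamma> x = cycle_of_list r x"
    using assms by (intro next_half_edge_eq_cycle) (auto simp: wf_graph_def)
  moreover have "next_half_edge \<gamma>' x = cycle_of_list r x"
    using assms by (intro next_half_edge_eq_cycle)
  ultimately show "next_half_edge \<gamma>' x = next_half_edge \<gamma> x" by simp
  show "next_half_edge \<gamma> x \<in> set r"
    unfolding eq using cycle_permutes[of r] assms(5) by (simp add: permutes_in_image)
qed

lemma split_at_two:
  assumes "i < j" "j < length xs"
  obtains A B D where "xs = A @ xs ! i # B @ xs ! j # D" "length A = i" "length B = j - Suc i"
proof
  let ?A = "take i xs" and ?B = "take (j - Suc i) (drop (Suc i) xs)" and ?D = "drop (Suc j) xs"
  have "xs = ?A @ xs ! i # drop (Suc i) xs" using assms by (intro id_take_nth_drop) simp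
  moreover have "drop (Suc i) xs = ?B @ drop (Suc i) xs ! (j - Suc i) # drop (Suc (j - Suc i)) (drop (Suc i) xs)"
    using assms by (intro id_take_nth_drop) simp
  ultimately show "xs = ?A @ xs ! i # ?B @ xs ! j # ?D" using assms by (simp add: add.commute)
qed (use assms in auto)

text \<open>In the spliced rotation \<open>as @ bs\<close> the end of \<open>as\<close>, formerly
  followed by \<open>h\<close>, is followed by the start of \<open>bs\<close>, the old successor of
  \<open>mate \<gamma> h\<close>, and symmetrically. If the list to be entered is empty, the walk
  returns to its own list; this is the inner case distinction of \<open>next'\<close>.\<close>

lemma contracts_edge_removal:
  assumes wf: "wf_graph \<gamma>" and contracts: "contracts_edge \<gamma> i j \<gamma>'"
  obtains h as bs where "edge_removal \<gamma> \<gamma>' h"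
    "cyclically_equal (rotations \<gamma> ! i) (h # as)" "cyclically_equal (rotations \<gamma> ! j) (mate \<gamma> h # bs)"
    "i < j" "j < num_vertices \<gamma>"
    "rotations \<gamma>' = remove_nth j ((rotations \<gamma>)[i := as @ bs])" "num_faces \<gamma> = num_faces \<gamma>'"
proof -
  let ?rs = "rotations \<gamma>"
  obtain h as bs where ij: "i < j" "j < num_vertices \<gamma>"
    and ci: "cyclically_equal (?rs ! i) (h # as)" and cj: "cyclically_equal (?rs ! j) (mate \<gamma> h # bs)"
    and \<gamma>': "\<gamma>' = \<lparr>rotations = remove_nth j (?rs[i := as @ bs]), mate = mate_without \<gamma> h\<rparr>"
    using contracts unfolding contracts_edge_def by blast
  let ?h' = "mate \<gamma> h"
  have dist: "distinct (concat ?rs)" using wf by (simp add: wf_graph_def)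
  obtain A B D where rs: "?rs = A @ ?rs ! i # B @ ?rs ! j # D" and len: "length A = i" "length B = j - Suc i"
    using split_at_two[of i j ?rs] ij by (auto simp: num_vertices_def)
  have "remove_nth j ((A @ r # B @ s # D)[i := as @ bs]) = A @ (as @ bs) # B @ D" for r s
  proof -
    have j: "j = length A + Suc (length B)" using ij(1) len by simp
    show ?thesis unfolding j len(1)[symmetric] by (simp add: remove_nth_def list_update_append)
  qed
  then have rs': "rotations \<gamma>' = A @ (as @ bs) # B @ D"
    unfolding \<gamma>' by (metis rs cell_graph.select_convs(1))
  have msets: "mset (?rs ! i) = mset (h # as)" "mset (?rs ! j) = mset (?h' # bs)"
    using mset_cyclically_equal ci cj by metis+
  have mem: "?rs ! i \<in> set ?rs" "?rs ! j \<in> set ?rs" using ij by (simp_all add: num_vertices_def)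
  have "mset (concat ?rs) = mset (h # ?h' # concat (rotations \<gamma>'))"
    by (subst rs) (simp add: rs' msets)
  note d = distinct_concat_remove_two[OF dist this]
  have h: "h \<in> half_edges \<gamma>" using d(2) by (simp add: half_edges_def)
  have H': "half_edges \<gamma>' = half_edges \<gamma> - {h, ?h'}" using d by (auto simp: half_edges_def)
  have dh: "h \<notin> set (concat (rotations \<gamma>'))" "?h' \<notin> set (concat (rotations \<gamma>'))" "?h' \<noteq> h"
    and d': "distinct (concat (rotations \<gamma>'))" using d(1) by auto
  have sh: "next_half_edge \<gamma> h = hd (as @ [h])" "next_half_edge \<gamma> ?h' = hd (bs @ [?h'])"
    using next_half_edge_eq[OF dist mem(1), of "[]" h as] next_half_edge_eq[OF dist mem(2), of "[]" ?h' bs]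
      ci cj by simp_all
  have rem: "edge_removal \<gamma> \<gamma>' h"
  proof
    show "mate \<gamma>' = mate_without \<gamma> h" by (simp add: \<gamma>')
    fix x assume "x \<in> half_edges \<gamma>'"
    then consider "x \<in> set as" | "x \<in> set bs" | r where "r \<in> set (A @ B @ D)" "x \<in> set r"
      by (auto simp: half_edges_def rs')
    then show "next_half_edge \<gamma>' x =
      (if next_half_edge \<gamma> x = h then
         (if next_half_edge \<gamma> ?h' = ?h' then next_half_edge \<gamma> h else next_half_edge \<gamma> ?h')
       else if next_half_edge \<gamma> x = ?h' then
         (if next_half_edge \<gamma> h = h then next_half_edge \<gamma> ?h' else next_half_edge \<gamma> h)
       else next_half_edge \<gamma> x)"
    proof cases
      case 1
      then obtain us vs where as: "as = us @ x # vs" by (meson split_list)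
      have "next_half_edge \<gamma> x = hd (vs @ (h # us) @ [x])"
        using ci by (intro next_half_edge_eq[OF dist mem(1)]) (simp add: as)
      moreover have "next_half_edge \<gamma>' x = hd ((vs @ bs) @ us @ [x])"
        by (rule next_half_edge_eq[OF d', of "as @ bs"])
           (auto simp: rs' as cyclically_equal_def intro!: exI[of _ 0])
      ultimately show ?thesis
        using dh by (cases vs; cases bs) (auto simp: sh as rs' hd_append split: if_splits)
    next
      case 2
      then obtain us vs where bs: "bs = us @ x # vs" by (meson split_list)
      have "next_half_edge \<gamma> x = hd (vs @ (?h' # us) @ [x])"
        using cj by (intro next_half_edge_eq[OF dist mem(2)]) (simp add: bs)
      moreover have "next_half_edge \<gamma>' x = hd (vs @ (as @ us) @ [x])"
        by (rule next_half_edge_eq[OF d', of "as @ bs"])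
           (auto simp: rs' bs cyclically_equal_def intro!: exI[of _ 0])
      ultimately show ?thesis
        using dh by (cases vs; cases as) (auto simp: sh bs rs' hd_append split: if_splits)
    next
      case 3
      have "r \<in> set ?rs" using 3(1) by (subst rs) auto
      moreover have "r \<in> set (rotations \<gamma>')" using 3(1) by (auto simp: rs')
      ultimately have "next_half_edge \<gamma>' x = next_half_edge \<gamma> x" "next_half_edge \<gamma> x \<in> set r"
        using next_unaffected[OF wf d' _ _ 3(2)] by auto
      moreover have "h \<notin> set r" "?h' \<notin> set r" using dh 3(1) by (auto simp: rs')
      ultimately show ?thesis by auto
    qed
  qed (fact wf h d' H')+
  then interpret edge_removal \<gamma> \<gamma>' h .
  have ne: "?rs ! i \<noteq> []" "?rs ! j \<noteq> []" using msets by auto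
  have "length (filter (\<lambda>r. r = []) ?rs) + (if as = [] \<and> bs = [] then 1 else 0) =
      length (filter (\<lambda>r. r = []) (rotations \<gamma>'))"
    by (subst rs) (simp add: rs' ne)
  \<comment> \<open>The two halves sit at different vertices, so the only face orbit that can vanish
    is the 2-cycle \<open>{h, mate \<gamma> h}\<close>. It occurs exactly when both lists are empty,
    and then the merged vertex has no half-edges and supplies the missing face.\<close>
  moreover have "next_half_edge \<gamma> ?h' \<noteq> h" "next_half_edge \<gamma> h \<noteq> ?h'"
    "(next_half_edge \<gamma> h = h \<and> next_half_edge \<gamma> ?h' = ?h') = (as = [] \<and> bs = [])"
    using dh by (cases as; cases bs; auto simp: sh rs')+
  ultimately have "num_faces \<gamma> = num_faces \<gamma>'"
    unfolding num_faces_alt card_face_orbits by auto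
  moreover have "rotations \<gamma>' = remove_nth j (?rs[i := as @ bs])" by (simp add: \<gamma>')
  ultimately show thesis using that rem ci cj ij by blast
qed

text \<open>Cutting the rotation at \<open>h\<close> and \<open>mate \<gamma> h\<close> closes
  \<open>as\<close> and \<open>bs\<close> into separate cycles: the end of \<open>as\<close>,
  formerly followed by \<open>mate \<gamma> h\<close>, now leads to the start of \<open>as\<close>,
  the old successor of \<open>h\<close>, and likewise for \<open>bs\<close>. This is the same
  formula \<open>next'\<close> as for a joining edge.\<close>

lemma contracts_loop_removal:
  assumes wf: "wf_graph \<gamma>" and contracts: "contracts_loop \<gamma> i \<gamma>'"
  obtains h as bs where "edge_removal \<gamma> \<gamma>' h" "i < num_vertices \<gamma>"
    "cyclically_equal (rotations \<gamma> ! i) (h # as @ mate \<gamma> h # bs)"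
    "rotations \<gamma>' = take i (rotations \<gamma>) @ [as, bs] @ drop (Suc i) (rotations \<gamma>)"
    "num_faces \<gamma> = num_faces \<gamma>'"
proof -
  let ?rs = "rotations \<gamma>"
  obtain h as bs where i: "i < num_vertices \<gamma>"
    and ci: "cyclically_equal (?rs ! i) (h # as @ mate \<gamma> h # bs)"
    and \<gamma>': "\<gamma>' = \<lparr>rotations = take i ?rs @ [as, bs] @ drop (Suc i) ?rs, mate = mate_without \<gamma> h\<rparr>"
    using contracts unfolding contracts_loop_def by blast
  let ?h' = "mate \<gamma> h"
  have dist: "distinct (concat ?rs)" using wf by (simp add: wf_graph_def)
  define A D where "A = take i ?rs" and "D = drop (Suc i) ?rs"
  have rs: "?rs = A @ ?rs ! i # D"
    using i unfolding A_def D_def by (intro id_take_nth_drop) (simp add: num_vertices_def)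
  have rs': "rotations \<gamma>' = A @ as # bs # D" by (simp add: \<gamma>' A_def D_def)
  have msets: "mset (?rs ! i) = mset (h # as @ ?h' # bs)"
    using mset_cyclically_equal ci by metis
  have mem: "?rs ! i \<in> set ?rs" using i by (simp add: num_vertices_def)
  have "mset (concat ?rs) = mset (h # ?h' # concat (rotations \<gamma>'))"
    by (subst rs) (simp add: rs' msets)
  note d = distinct_concat_remove_two[OF dist this]
  have h: "h \<in> half_edges \<gamma>" using d(2) by (simp add: half_edges_def)
  have H': "half_edges \<gamma>' = half_edges \<gamma> - {h, ?h'}" using d by (auto simp: half_edges_def)
  have dh: "h \<notin> set (concat (rotations \<gamma>'))" "?h' \<notin> set (concat (rotations \<gamma>'))" "?h' \<noteq> h"
    and d': "distinct (concat (rotations \<gamma>'))" using d(1) by auto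
  have sh: "next_half_edge \<gamma> h = hd (as @ [?h'])" "next_half_edge \<gamma> ?h' = hd (bs @ [h])"
    using next_half_edge_eq[OF dist mem, of "[]" h "as @ ?h' # bs"]
      next_half_edge_eq[OF dist mem, of "h # as" ?h' bs] ci
    by (cases as; cases bs; simp)+
  have rem: "edge_removal \<gamma> \<gamma>' h"
  proof
    show "mate \<gamma>' = mate_without \<gamma> h" by (simp add: \<gamma>')
    fix x assume "x \<in> half_edges \<gamma>'"
    then consider "x \<in> set as" | "x \<in> set bs" | r where "r \<in> set (A @ D)" "x \<in> set r"
      by (auto simp: half_edges_def rs')
    then show "next_half_edge \<gamma>' x =
      (if next_half_edge \<gamma> x = h then
         (if next_half_edge \<gamma> ?h' = ?h' then next_half_edge \<gamma> h else next_half_edge \<gamma> ?h')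
       else if next_half_edge \<gamma> x = ?h' then
         (if next_half_edge \<gamma> h = h then next_half_edge \<gamma> ?h' else next_half_edge \<gamma> h)
       else next_half_edge \<gamma> x)"
    proof cases
      case 1
      then obtain us vs where as: "as = us @ x # vs" by (meson split_list)
      have "next_half_edge \<gamma> x = hd ((vs @ ?h' # bs) @ (h # us) @ [x])"
        using ci by (intro next_half_edge_eq[OF dist mem]) (simp add: as)
      moreover have "next_half_edge \<gamma>' x = hd (vs @ us @ [x])"
        by (rule next_half_edge_eq[OF d', of as])
           (auto simp: rs' as cyclically_equal_def intro!: exI[of _ 0])
      ultimately show ?thesis
        using dh by (cases vs; cases us) (auto simp: sh as rs' hd_append split: if_splits)
    next
      case 2
      then obtain us vs where bs: "bs = us @ x # vs" by (meson split_list)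
      have "next_half_edge \<gamma> x = hd (vs @ (h # as @ ?h' # us) @ [x])"
        using ci by (intro next_half_edge_eq[OF dist mem]) (simp add: bs)
      moreover have "next_half_edge \<gamma>' x = hd (vs @ us @ [x])"
        by (rule next_half_edge_eq[OF d', of bs])
           (auto simp: rs' bs cyclically_equal_def intro!: exI[of _ 0])
      ultimately show ?thesis
        using dh by (cases vs; cases us) (auto simp: sh bs rs' hd_append split: if_splits)
    next
      case 3
      have "r \<in> set ?rs" using 3(1) by (subst rs) auto
      moreover have "r \<in> set (rotations \<gamma>')" using 3(1) by (auto simp: rs')
      ultimately have "next_half_edge \<gamma>' x = next_half_edge \<gamma> x" "next_half_edge \<gamma> x \<in> set r"
        using next_unaffected[OF wf d' _ _ 3(2)] by auto
      moreover have "h \<notin> set r" "?h' \<notin> set r" using dh 3(1) by (auto simp: rs')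
      ultimately show ?thesis by auto
    qed
  qed (fact wf h d' H')+
  then interpret edge_removal \<gamma> \<gamma>' h .
  have ne: "?rs ! i \<noteq> []" using msets by auto
  have "length (filter (\<lambda>r. r = []) ?rs) + (if as = [] then 1 else 0) + (if bs = [] then 1 else 0) =
      length (filter (\<lambda>r. r = []) (rotations \<gamma>'))"
    by (subst rs) (simp add: rs' ne)
  \<comment> \<open>An empty side of the loop is a face bounded by the loop alone. It is lost among
    the orbits and returns as the vertex without half-edges on that side.\<close>
  moreover have "(next_half_edge \<gamma> ?h' = h) = (bs = [])" "(next_half_edge \<gamma> h = ?h') = (as = [])"
    "next_half_edge \<gamma> h \<noteq> h"
    using dh by (cases as; cases bs; auto simp: sh rs')+
  ultimately have "num_faces \<gamma> = num_faces \<gamma>'"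
    unfolding num_faces_alt card_face_orbits by auto
  moreover have "rotations \<gamma>' = take i ?rs @ [as, bs] @ drop (Suc i) ?rs" by (simp add: \<gamma>')
  ultimately show thesis using that rem ci i by blast
qed

section \<open>Connectivity\<close>

lemma distinct_concat_nth_unique:
  assumes "distinct (concat rs)" "k < length rs" "l < length rs" "x \<in> set (rs ! k)" "x \<in> set (rs ! l)"
  shows "k = l"
  using assms
proof (induction rs arbitrary: k l)
  case (Cons r rs)
  have "x \<in> set r \<Longrightarrow> m < length rs \<Longrightarrow> x \<notin> set (rs ! m)" for m
    using Cons.prems(1) by (auto dest: nth_mem)
  with Cons show ?case by (cases k; cases l) auto
qed simp

lemma half_edge_at:
  assumes "x \<in> half_edges \<gamma>"
  obtains k where "k < num_vertices \<gamma>" "x \<in> set (rotations \<gamma> ! k)"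
proof -
  obtain r where "r \<in> set (rotations \<gamma>)" "x \<in> set r" using assms by (auto simp: half_edges_def)
  then show thesis using that by (metis in_set_conv_nth num_vertices_def)
qed

lemma half_edgesI: "k < num_vertices \<gamma> \<Longrightarrow> x \<in> set (rotations \<gamma> ! k) \<Longrightarrow> x \<in> half_edges \<gamma>"
  by (auto simp: half_edges_def num_vertices_def)

lemma half_edge_unique:
  assumes "wf_graph \<gamma>" "k < num_vertices \<gamma>" "l < num_vertices \<gamma>"
    "x \<in> set (rotations \<gamma> ! k)" "x \<in> set (rotations \<gamma> ! l)"
  shows "k = l"
  by (rule distinct_concat_nth_unique[of "rotations \<gamma>" k l x])
     (use assms in \<open>simp_all add: wf_graph_def num_vertices_def\<close>)

lemma adjacencyI:
  assumes "k < num_vertices \<gamma>" "l < num_vertices \<gamma>"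
    "x \<in> set (rotations \<gamma> ! k)" "mate \<gamma> x \<in> set (rotations \<gamma> ! l)"
  shows "(k, l) \<in> adjacency \<gamma>"
  using assms by (auto simp: adjacency_def)

lemma adjacency_less: "(k, l) \<in> adjacency \<gamma> \<Longrightarrow> k < num_vertices \<gamma> \<and> l < num_vertices \<gamma>"
  by (auto simp: adjacency_def)

lemma sym_adjacency_rtrancl:
  assumes "wf_graph \<gamma>"
  shows "sym ((adjacency \<gamma>)\<^sup>*)"
proof (intro sym_rtrancl symI)
  fix k l assume "(k, l) \<in> adjacency \<gamma>"
  then obtain x where x: "k < num_vertices \<gamma>" "l < num_vertices \<gamma>"
      "x \<in> set (rotations \<gamma> ! k)" "mate \<gamma> x \<in> set (rotations \<gamma> ! l)"
    by (auto simp: adjacency_def)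
  moreover have "mate \<gamma> (mate \<gamma> x) = x"
    using assms half_edgesI[OF x(1,3)] by (simp add: wf_graph_def)
  ultimately show "(l, k) \<in> adjacency \<gamma>" by (intro adjacencyI[of l \<gamma> k "mate \<gamma> x"]) auto
qed

text \<open>Connectivity is treated through closed vertex sets instead of paths: such sets can be
  pulled back or pushed forward along the relabelling of vertices that a contraction induces,
  without rewriting any path.\<close>

definition adjacency_closed :: "cell_graph \<Rightarrow> nat set \<Rightarrow> bool" where
  "adjacency_closed \<gamma> U \<longleftrightarrow> U \<subseteq> {..<num_vertices \<gamma>} \<and> (\<forall>k l. (k, l) \<in> adjacency \<gamma> \<longrightarrow> k \<in> U \<longrightarrow> l \<in> U)"

lemma adjacency_closed_rtrancl:
  assumes "adjacency_closed \<gamma> U" "(k, l) \<in> (adjacency \<gamma>)\<^sup>*" "k \<in> U"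
  shows "l \<in> U"
  using assms(2,3) by induction (use assms(1) in \<open>auto simp: adjacency_closed_def\<close>)

lemma adjacency_closed_component: "adjacency_closed \<gamma> (component_of \<gamma> i)"
  by (auto simp: adjacency_closed_def component_of_def dest: adjacency_less intro: rtrancl_into_rtrancl)

lemma connected_graph_closed:
  assumes "connected_graph \<gamma>" "adjacency_closed \<gamma> U" "U \<noteq> {}"
  shows "U = {..<num_vertices \<gamma>}"
proof -
  obtain k where k: "k \<in> U" using assms(3) by auto
  moreover have U: "U \<subseteq> {..<num_vertices \<gamma>}" using assms(2) by (simp add: adjacency_closed_def)
  ultimately have "l \<in> U" if "l < num_vertices \<gamma>" for l
    using assms(1) that k adjacency_closed_rtrancl[OF assms(2), of k l] by (auto simp: connected_graph_def)
  with U show ?thesis by auto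
qed

lemma connected_graphI:
  assumes "\<And>U. adjacency_closed \<gamma> U \<Longrightarrow> U \<noteq> {} \<Longrightarrow> U = {..<num_vertices \<gamma>}"
  shows "connected_graph \<gamma>"
  unfolding connected_graph_def
proof (intro allI impI)
  fix i j assume "i < num_vertices \<gamma>" "j < num_vertices \<gamma>"
  moreover from this have "component_of \<gamma> i = {..<num_vertices \<gamma>}"
    by (intro assms adjacency_closed_component) (auto simp: component_of_def)
  ultimately show "(i, j) \<in> (adjacency \<gamma>)\<^sup>*" by (auto simp: component_of_def)
qed

lemma remove_nth_nth: "k < length xs - 1 \<Longrightarrow> remove_nth j xs ! k = (if k < j then xs ! k else xs ! Suc k)"
  by (auto simp: remove_nth_def nth_append min_def not_less)

lemma length_remove_nth: "j < length xs \<Longrightarrow> length (remove_nth j xs) = length xs - 1"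
  by (simp add: remove_nth_def)

text \<open>The map \<open>f\<close> is the quotient map on vertices: it sends \<open>j\<close> to
  the merged vertex \<open>i\<close> and lowers the labels above \<open>j\<close>. The contracted
  edge collapses to \<open>i\<close> and every other edge goes to an edge of
  \<open>\<gamma>'\<close>, so the preimage of a closed set is closed in \<open>\<gamma>\<close>,
  hence everything; \<open>f\<close> is onto.\<close>

lemma connected_contracts_edge:
  assumes wf: "wf_graph \<gamma>" and conn: "connected_graph \<gamma>" and contracts: "contracts_edge \<gamma> i j \<gamma>'"
  shows "connected_graph \<gamma>'"
proof -
  obtain h as bs where rem: "edge_removal \<gamma> \<gamma>' h"
    and ci: "cyclically_equal (rotations \<gamma> ! i) (h # as)"
    and cj: "cyclically_equal (rotations \<gamma> ! j) (mate \<gamma> h # bs)"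
    and ij: "i < j" "j < num_vertices \<gamma>"
    and rs': "rotations \<gamma>' = remove_nth j ((rotations \<gamma>)[i := as @ bs])"
    using contracts_edge_removal[OF wf contracts] by blast
  interpret edge_removal \<gamma> \<gamma>' h by fact
  let ?n = "num_vertices \<gamma>"
  have n': "num_vertices \<gamma>' = ?n - 1"
    unfolding num_vertices_def rs' using ij(2) by (simp add: length_remove_nth num_vertices_def)
  define f where "f k = (if k = j then i else if k < j then k else k - 1)" for k
  have f_less: "f k < num_vertices \<gamma>'" if "k < ?n" for k
    using that ij by (auto simp: f_def n')
  have seti: "set (rotations \<gamma> ! i) = insert h (set as)"
    and setj: "set (rotations \<gamma> ! j) = insert (mate \<gamma> h) (set bs)"
    using set_cyclically_equal[OF ci] set_cyclically_equal[OF cj] by simp_all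
  have at: "x \<in> set (rotations \<gamma>' ! f k)" if "k < ?n" "x \<in> set (rotations \<gamma> ! k)" "x \<noteq> h" "x \<noteq> mate \<gamma> h" for x k
  proof -
    have "f k < length (rotations \<gamma>) - 1" using f_less[OF that(1)] n' by (simp add: num_vertices_def)
    then show ?thesis using that ij seti setj
      by (auto simp: rs' remove_nth_nth f_def nth_list_update num_vertices_def)
  qed
  have fh: "f k = i" if "k < ?n" "x \<in> set (rotations \<gamma> ! k)" "x = h \<or> x = mate \<gamma> h" for k x
  proof -
    have "k = i \<or> k = j"
      using half_edge_unique[OF wf that(1), of i x] half_edge_unique[OF wf that(1), of j x] that ij seti setj
      by auto
    then show ?thesis using ij by (auto simp: f_def)
  qed
  show ?thesis
  proof (rule connected_graphI)
    fix U assume U: "adjacency_closed \<gamma>' U" "U \<noteq> {}"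
    define W where "W = {k. k < ?n \<and> f k \<in> U}"
    have surj: "\<exists>k<?n. f k = u" if "u < num_vertices \<gamma>'" for u
      using that ij by (intro exI[of _ "if u < j then u else Suc u"]) (auto simp: f_def n')
    have U_less: "u < num_vertices \<gamma>'" if "u \<in> U" for u using U(1) that by (auto simp: adjacency_closed_def)
    have "adjacency_closed \<gamma> W"
      unfolding adjacency_closed_def
    proof (intro conjI allI impI)
      fix k l assume "(k, l) \<in> adjacency \<gamma>" "k \<in> W"
      then obtain x where x: "k < ?n" "l < ?n" "x \<in> set (rotations \<gamma> ! k)" "mate \<gamma> x \<in> set (rotations \<gamma> ! l)"
        and k: "f k \<in> U" by (auto simp: adjacency_def W_def)
      have "x \<in> half_edges \<gamma>" using x by (intro half_edgesI)
      show "l \<in> W"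
      proof (cases "x = h \<or> x = mate \<gamma> h")
        case True
        then have "f k = i" "f l = i" using x mate_h by (auto intro!: fh)
        then show ?thesis using k x(2) by (simp add: W_def)
      next
        case False
        then have "x \<in> half_edges \<gamma>'" using \<open>x \<in> half_edges \<gamma>\<close> half_edges' by auto
        note m = mate_in[OF this]
        have "mate \<gamma> x \<noteq> h" "mate \<gamma> x \<noteq> mate \<gamma> h" using m(1) half_edges' by auto
        then have "(f k, f l) \<in> adjacency \<gamma>'"
          using x False by (intro adjacencyI[of _ _ _ x] f_less at) (simp_all add: m(2) at)
        then show ?thesis using U(1) k x(2) by (auto simp: adjacency_closed_def W_def)
      qed
    qed (auto simp: W_def)
    moreover have "W \<noteq> {}" using U(2) U_less surj by (fastforce simp: W_def)
    ultimately have "W = {..<?n}" using connected_graph_closed[OF conn] by blast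
    then have "u \<in> U" if "u < num_vertices \<gamma>'" for u using surj[OF that] by (auto simp: W_def)
    then show "U = {..<num_vertices \<gamma>'}" using U_less by auto
  qed
qed

text \<open>Identifying the two new vertices turns \<open>\<gamma>'\<close> back into
  \<open>\<gamma>\<close> without the loop. A closed set that contains both of them is saturated for
  this identification, so its image is closed in the connected graph
  \<open>\<gamma>\<close>.\<close>

lemma contracts_loop_closed:
  assumes wf: "wf_graph \<gamma>" and conn: "connected_graph \<gamma>" and contracts: "contracts_loop \<gamma> i \<gamma>'"
    and U: "adjacency_closed \<gamma>' U" "i \<in> U" "Suc i \<in> U"
  shows "U = {..<num_vertices \<gamma>'}"
proof -
  obtain h as bs where rem: "edge_removal \<gamma> \<gamma>' h" and i: "i < num_vertices \<gamma>"
    and ci: "cyclically_equal (rotations \<gamma> ! i) (h # as @ mate \<gamma> h # bs)"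
    and rs': "rotations \<gamma>' = take i (rotations \<gamma>) @ [as, bs] @ drop (Suc i) (rotations \<gamma>)"
    using contracts_loop_removal[OF wf contracts] by blast
  interpret edge_removal \<gamma> \<gamma>' h by fact
  let ?n = "num_vertices \<gamma>"
  have n': "num_vertices \<gamma>' = Suc ?n"
    unfolding num_vertices_def rs' using i by (simp add: num_vertices_def)
  \<comment> \<open>The new position of an old vertex other than \<open>i\<close>; the value at
    \<open>i\<close> itself stands for only one of its two successors, which is why \<open>W\<close>
    below admits \<open>i\<close> separately.\<close>
  define q where "q k = (if k \<le> i then k else Suc k)" for k
  have seti: "set (rotations \<gamma> ! i) = {h, mate \<gamma> h} \<union> set as \<union> set bs"
    using set_cyclically_equal[OF ci] by auto
  have at_i: "rotations \<gamma>' ! i = as" "rotations \<gamma>' ! Suc i = bs"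
    using i by (simp_all add: rs' nth_append num_vertices_def)
  have at: "rotations \<gamma>' ! q k = rotations \<gamma> ! k" if "k < ?n" "k \<noteq> i" for k
    using that i by (auto simp: rs' q_def nth_append num_vertices_def min_def)
  have q_less: "q k < num_vertices \<gamma>'" if "k < ?n" for k using that by (simp add: q_def n')
  define W where "W = {k. k < ?n \<and> (k = i \<or> q k \<in> U)}"
  have "adjacency_closed \<gamma> W"
    unfolding adjacency_closed_def
  proof (intro conjI allI impI)
    fix k l assume "(k, l) \<in> adjacency \<gamma>" and kW: "k \<in> W"
    then obtain x where x: "k < ?n" "l < ?n" "x \<in> set (rotations \<gamma> ! k)" "mate \<gamma> x \<in> set (rotations \<gamma> ! l)"
      by (auto simp: adjacency_def)
    show "l \<in> W"
    proof (cases "l = i")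
      case True
      then show ?thesis using i by (simp add: W_def)
    next
      case False
      have "mate \<gamma> x \<notin> set (rotations \<gamma> ! i)"
        using half_edge_unique[OF wf x(2) i x(4)] False by blast
      then have m: "mate \<gamma> x \<noteq> h" "mate \<gamma> x \<noteq> mate \<gamma> h" using seti by auto
      have xH: "x \<in> half_edges \<gamma>" using x by (intro half_edgesI)
      with m mate_h(3) have x': "x \<in> half_edges \<gamma>'" using half_edges' by auto
      obtain k' where k': "k' \<in> U" "x \<in> set (rotations \<gamma>' ! k')"
      proof (cases "k = i")
        case True
        then have "x \<in> set as \<or> x \<in> set bs" using x(3) seti x' half_edges' by auto
        then show ?thesis using that U at_i by metis
      next
        case False
        then show ?thesis using kW x(1,3) at[of k] that[of "q k"] by (auto simp: W_def)
      qed
      have "(k', q l) \<in> adjacency \<gamma>'"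
        using k' U(1) x False mate_in(2)[OF x']
        by (intro adjacencyI[of _ _ _ x] q_less) (auto simp: adjacency_closed_def at)
      then show ?thesis using U(1) k'(1) x(2) by (auto simp: adjacency_closed_def W_def)
    qed
  qed (auto simp: W_def)
  moreover have "i \<in> W" using i by (simp add: W_def)
  ultimately have W: "W = {..<?n}" using connected_graph_closed[OF conn] by blast
  have "u \<in> U" if u: "u < num_vertices \<gamma>'" for u
  proof -
    consider "u = i" | "u = Suc i" | "u < i" | "u > Suc i" by linarith
    then show ?thesis
    proof cases
      case 3
      then have "u \<in> W" using i by (simp add: W)
      with 3 show ?thesis by (simp add: W_def q_def)
    next
      case 4
      then have "u - 1 \<in> W" using u by (simp add: W n')
      with 4 show ?thesis by (simp add: W_def q_def split: if_splits)
    qed (use U in auto)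
  qed
  then show ?thesis using U(1) by (auto simp: adjacency_closed_def)
qed

text \<open>The union of the two components is closed and contains both new vertices, so it is
  everything. If they met, the component of \<open>i\<close> would contain \<open>Suc i\<close> as
  well, would therefore be everything, and \<open>\<gamma>'\<close> would be connected.\<close>

lemma contracts_loop_components:
  assumes wf: "wf_graph \<gamma>" and conn: "connected_graph \<gamma>" and contracts: "contracts_loop \<gamma> i \<gamma>'"
    and disc: "\<not> connected_graph \<gamma>'"
  shows "component_of \<gamma>' i \<union> component_of \<gamma>' (Suc i) = {..<num_vertices \<gamma>'}"
    "component_of \<gamma>' i \<inter> component_of \<gamma>' (Suc i) = {}"
    "i \<in> component_of \<gamma>' i" "Suc i \<in> component_of \<gamma>' (Suc i)"
proof -
  obtain h as bs where rem: "edge_removal \<gamma> \<gamma>' h" and i: "i < num_vertices \<gamma>"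
    and rs': "rotations \<gamma>' = take i (rotations \<gamma>) @ [as, bs] @ drop (Suc i) (rotations \<gamma>)"
    using contracts_loop_removal[OF wf contracts] by blast
  interpret edge_removal \<gamma> \<gamma>' h by fact
  let ?S1 = "component_of \<gamma>' i" and ?S2 = "component_of \<gamma>' (Suc i)"
  have n': "num_vertices \<gamma>' = Suc (num_vertices \<gamma>)"
    unfolding num_vertices_def rs' using i by (simp add: num_vertices_def)
  show i_in: "i \<in> ?S1" and "Suc i \<in> ?S2" using i n' by (simp_all add: component_of_def)
  have "adjacency_closed \<gamma>' (?S1 \<union> ?S2)"
    using adjacency_closed_component[of \<gamma>' i] adjacency_closed_component[of \<gamma>' "Suc i"]
    unfolding adjacency_closed_def by blast
  then show "?S1 \<union> ?S2 = {..<num_vertices \<gamma>'}"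
    using contracts_loop_closed[OF wf conn contracts] i_in \<open>Suc i \<in> ?S2\<close> by blast
  show "?S1 \<inter> ?S2 = {}"
  proof (rule ccontr)
    assume "?S1 \<inter> ?S2 \<noteq> {}"
    then obtain k where "(i, k) \<in> (adjacency \<gamma>')\<^sup>*" "(Suc i, k) \<in> (adjacency \<gamma>')\<^sup>*"
      by (auto simp: component_of_def)
    then have "(i, Suc i) \<in> (adjacency \<gamma>')\<^sup>*"
      using symD[OF sym_adjacency_rtrancl[OF wf']] rtrancl_trans by metis
    then have "Suc i \<in> ?S1" using i n' by (simp add: component_of_def)
    then have "?S1 = {..<num_vertices \<gamma>'}"
      using contracts_loop_closed[OF wf conn contracts adjacency_closed_component i_in] by blast
    then have "(i, k) \<in> (adjacency \<gamma>')\<^sup>*" if "k < num_vertices \<gamma>'" for k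
      using that by (auto simp: component_of_def)
    then have "connected_graph \<gamma>'"
      unfolding connected_graph_def
      using symD[OF sym_adjacency_rtrancl[OF wf']] rtrancl_trans by metis
    with disc show False by contradiction
  qed
qed

section \<open>Subgraphs and the Euler characteristic\<close>

text \<open>This one identity later splits the number of vertices, the number of vertices without
  half-edges, and the product of the arguments of a multilinear map.\<close>

lemma mset_nths_partition:
  assumes "\<And>k. k < length xs \<Longrightarrow> (k \<in> S1) \<noteq> (k \<in> S2)"
  shows "mset (nths xs S1) + mset (nths xs S2) = mset xs"
  using assms
proof (induction xs rule: rev_induct)
  case (snoc x xs)
  have "mset (nths xs S1) + mset (nths xs S2) = mset xs"
    using snoc.prems by (intro snoc.IH) simp
  moreover have "(length xs \<in> S1) \<noteq> (length xs \<in> S2)" using snoc.prems[of "length xs"] by simp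
  ultimately show ?case by (auto simp: nths_append)
qed simp

lemma nths_alt: "nths xs S = map ((!) xs) (filter (\<lambda>k. k \<in> S) [0..<length xs])"
proof -
  have "zip xs [0..<length xs] = map (\<lambda>k. (xs ! k, k)) [0..<length xs]"
    by (intro nth_equalityI) auto
  then show ?thesis by (simp add: nths_def filter_map o_def)
qed

lemma distinct_concat_nths: "distinct (concat xs) \<Longrightarrow> distinct (concat (nths xs S))"
proof (induction xs rule: rev_induct)
  case (snoc x xs)
  have "set (concat (nths xs S)) \<subseteq> set (concat xs)" using set_nths_subset[of xs S] by auto
  with snoc show ?case by (auto simp: nths_append)
qed simp

lemma card_image_disjoint_classes:
  assumes "finite A" "finite B" "A \<inter> B = {}"
    and "\<And>x. x \<in> A \<Longrightarrow> F x \<subseteq> A \<and> F x \<noteq> {}" "\<And>x. x \<in> B \<Longrightarrow> F x \<subseteq> B \<and> F x \<noteq> {}"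
  shows "card (F ` (A \<union> B)) = card (F ` A) + card (F ` B)"
proof -
  have "F ` A \<inter> F ` B = {}"
  proof (rule ccontr)
    assume "F ` A \<inter> F ` B \<noteq> {}"
    then obtain a b where ab: "a \<in> A" "b \<in> B" "F a = F b" by blast
    then have "F a \<subseteq> A \<inter> B" "F a \<noteq> {}" using assms(4)[OF ab(1)] assms(5)[OF ab(2)] by auto
    with assms(3) show False by simp
  qed
  with assms(1,2) show ?thesis by (simp add: image_Un card_Un_disjoint)
qed

definition euler_char :: "cell_graph \<Rightarrow> int" where
  "euler_char \<gamma> = int (num_vertices \<gamma>) - int (card (edges \<gamma>)) + int (num_faces \<gamma>)"

lemma cell_graphs_iff:
  "\<gamma> \<in> cell_graphs g n \<longleftrightarrow> wf_graph \<gamma> \<and> connected_graph \<gamma> \<and> num_vertices \<gamma> = n \<and> n \<ge> 1 \<and>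
     euler_char \<gamma> = 2 - 2 * int g"
  by (auto simp: cell_graphs_def euler_char_def)

text \<open>As adjacency is symmetric, a closed set of vertices is a union of components. The
  subgraph on it therefore keeps both halves of each of its edges and every face walk that starts in
  it.\<close>

locale closed_subgraph =
  fixes \<gamma> :: cell_graph and S :: "nat set"
  assumes wf: "wf_graph \<gamma>" and closed: "adjacency_closed \<gamma> S"
begin

lemma S_less: "k \<in> S \<Longrightarrow> k < num_vertices \<gamma>"
  using closed by (auto simp: adjacency_closed_def)

lemma rotations_sub: "rotations (subgraph_on \<gamma> S) = nths (rotations \<gamma>) S"
  by (simp add: subgraph_on_def)

lemma half_edges_sub: "half_edges (subgraph_on \<gamma> S) = (\<Union>k\<in>S. set (rotations \<gamma> ! k))"
  using S_less by (auto simp: half_edges_def rotations_sub set_nths num_vertices_def)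

lemma half_edges_sub_subset: "half_edges (subgraph_on \<gamma> S) \<subseteq> half_edges \<gamma>"
  using half_edgesI S_less unfolding half_edges_sub by blast

lemma mate_sub:
  assumes "x \<in> half_edges (subgraph_on \<gamma> S)"
  shows "mate (subgraph_on \<gamma> S) x = mate \<gamma> x" "mate \<gamma> x \<in> half_edges (subgraph_on \<gamma> S)"
proof -
  show "mate (subgraph_on \<gamma> S) x = mate \<gamma> x"
    using assms unfolding half_edges_def subgraph_on_def by simp
  obtain k where k: "k \<in> S" "x \<in> set (rotations \<gamma> ! k)" using assms unfolding half_edges_sub by blast
  have "mate \<gamma> x \<in> half_edges \<gamma>"
    using assms half_edges_sub_subset wf by (auto simp: wf_graph_def permutes_in_image)
  then obtain l where l: "l < num_vertices \<gamma>" "mate \<gamma> x \<in> set (rotations \<gamma> ! l)" by (rule half_edge_at)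
  have "(k, l) \<in> adjacency \<gamma>" using k l S_less by (intro adjacencyI[of _ _ _ x])
  then have "l \<in> S" using closed k by (auto simp: adjacency_closed_def)
  with l show "mate \<gamma> x \<in> half_edges (subgraph_on \<gamma> S)" unfolding half_edges_sub by blast
qed

lemma wf_sub: "wf_graph (subgraph_on \<gamma> S)"
proof -
  have inv: "mate (subgraph_on \<gamma> S) x \<noteq> x \<and> mate (subgraph_on \<gamma> S) (mate (subgraph_on \<gamma> S) x) = x"
    if "x \<in> half_edges (subgraph_on \<gamma> S)" for x
    using that mate_sub[of x] mate_sub[of "mate \<gamma> x"] wf half_edges_sub_subset
    by (auto simp: wf_graph_def)
  have "mate (subgraph_on \<gamma> S) permutes half_edges (subgraph_on \<gamma> S)"
    by (rule involution_permutes)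
      (use inv mate_sub in \<open>auto simp: half_edges_def subgraph_on_def\<close>)
  moreover have "distinct (concat (rotations (subgraph_on \<gamma> S)))"
    using wf by (simp add: rotations_sub distinct_concat_nths wf_graph_def)
  ultimately show ?thesis using inv by (simp add: wf_graph_def)
qed

lemma edges_sub: "edges (subgraph_on \<gamma> S) = (\<lambda>x. {x, mate \<gamma> x}) ` half_edges (subgraph_on \<gamma> S)"
  unfolding edges_alt using mate_sub(1) by (intro image_cong) auto

lemma face_perm_sub:
  assumes "x \<in> half_edges (subgraph_on \<gamma> S)"
  shows "face_perm (subgraph_on \<gamma> S) x = face_perm \<gamma> x"
proof -
  let ?y = "mate \<gamma> x"
  obtain r where r: "r \<in> set (rotations (subgraph_on \<gamma> S))" "?y \<in> set r"
    using mate_sub(2)[OF assms] unfolding half_edges_def by auto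
  have "r \<in> set (rotations \<gamma>)" using r(1) unfolding rotations_sub by (rule in_set_nthsD)
  with r wf wf_sub have "next_half_edge (subgraph_on \<gamma> S) ?y = next_half_edge \<gamma> ?y"
    by (intro next_unaffected(1)[of _ _ r]) (simp_all add: wf_graph_def)
  then show ?thesis by (simp add: face_perm_def mate_sub(1)[OF assms])
qed

lemma orbit_sub:
  assumes "x \<in> half_edges (subgraph_on \<gamma> S)"
  shows "orbit (face_perm (subgraph_on \<gamma> S)) x = orbit (face_perm \<gamma>) x"
  by (rule orbit_cong0[OF assms _ face_perm_sub])
    (use face_perm_permutes[OF wf_sub] in \<open>auto simp: permutes_in_image\<close>)

lemma orbits_sub:
  "orbit (face_perm (subgraph_on \<gamma> S)) ` half_edges (subgraph_on \<gamma> S) =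
     orbit (face_perm \<gamma>) ` half_edges (subgraph_on \<gamma> S)"
  by (intro image_cong refl orbit_sub)

lemma orbit_subset_sub:
  assumes "x \<in> half_edges (subgraph_on \<gamma> S)"
  shows "orbit (face_perm \<gamma>) x \<subseteq> half_edges (subgraph_on \<gamma> S)"
  using permutes_orbit_subset[OF face_perm_permutes[OF wf_sub] assms] orbit_sub[OF assms] by simp

end

text \<open>No edge and no face orbit meets both vertex sets, so vertices, edges and both kinds of
  faces are counted separately on the two sides.\<close>

lemma euler_char_components:
  assumes wf: "wf_graph \<gamma>" and closed: "adjacency_closed \<gamma> S1" "adjacency_closed \<gamma> S2"
    and un: "S1 \<union> S2 = {..<num_vertices \<gamma>}" and disj: "S1 \<inter> S2 = {}"
  shows "euler_char \<gamma> = euler_char (subgraph_on \<gamma> S1) + euler_char (subgraph_on \<gamma> S2)"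
proof -
  interpret s1: closed_subgraph \<gamma> S1 by unfold_locales fact+
  interpret s2: closed_subgraph \<gamma> S2 by unfold_locales fact+
  let ?H1 = "half_edges (subgraph_on \<gamma> S1)" and ?H2 = "half_edges (subgraph_on \<gamma> S2)"
  have part: "mset (nths (rotations \<gamma>) S1) + mset (nths (rotations \<gamma>) S2) = mset (rotations \<gamma>)"
    using un disj by (intro mset_nths_partition) (auto simp: num_vertices_def)
  have V: "num_vertices \<gamma> = num_vertices (subgraph_on \<gamma> S1) + num_vertices (subgraph_on \<gamma> S2)"
    using arg_cong[OF part, of size] by (simp add: num_vertices_def s1.rotations_sub s2.rotations_sub)
  have empty: "length (filter (\<lambda>r. r = []) (rotations \<gamma>)) =
      length (filter (\<lambda>r. r = []) (rotations (subgraph_on \<gamma> S1))) +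
      length (filter (\<lambda>r. r = []) (rotations (subgraph_on \<gamma> S2)))"
    using arg_cong[OF part, of "\<lambda>M. size (filter_mset (\<lambda>r. r = []) M)"]
    by (simp add: s1.rotations_sub s2.rotations_sub flip: mset_filter)
  have H: "half_edges \<gamma> = ?H1 \<union> ?H2"
  proof
    show "half_edges \<gamma> \<subseteq> ?H1 \<union> ?H2"
    proof
      fix x assume "x \<in> half_edges \<gamma>"
      then obtain k where "k < num_vertices \<gamma>" "x \<in> set (rotations \<gamma> ! k)" by (rule half_edge_at)
      moreover from this have "k \<in> S1 \<union> S2" using un by simp
      ultimately show "x \<in> ?H1 \<union> ?H2" unfolding s1.half_edges_sub s2.half_edges_sub by blast
    qed
  qed (use s1.half_edges_sub_subset s2.half_edges_sub_subset in auto)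
  have disjH: "?H1 \<inter> ?H2 = {}"
  proof (rule ccontr)
    assume "?H1 \<inter> ?H2 \<noteq> {}"
    then obtain x k l where "k \<in> S1" "l \<in> S2" "x \<in> set (rotations \<gamma> ! k)" "x \<in> set (rotations \<gamma> ! l)"
      unfolding s1.half_edges_sub s2.half_edges_sub by blast
    then have "k = l" using s1.S_less s2.S_less by (intro half_edge_unique[OF wf])
    with \<open>k \<in> S1\<close> \<open>l \<in> S2\<close> disj show False by blast
  qed
  have "card (edges \<gamma>) = card (edges (subgraph_on \<gamma> S1)) + card (edges (subgraph_on \<gamma> S2))"
    unfolding s1.edges_sub s2.edges_sub unfolding edges_alt[of \<gamma>] H
    by (intro card_image_disjoint_classes disjH) (simp_all add: s1.mate_sub s2.mate_sub)
  moreover have "card (orbit (face_perm \<gamma>) ` half_edges \<gamma>) =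
      card (orbit (face_perm (subgraph_on \<gamma> S1)) ` ?H1) + card (orbit (face_perm (subgraph_on \<gamma> S2)) ` ?H2)"
    unfolding H s1.orbits_sub s2.orbits_sub
    by (intro card_image_disjoint_classes disjH)
      (simp_all add: s1.orbit_subset_sub s2.orbit_subset_sub orbit_nonempty)
  ultimately show ?thesis using V empty by (simp add: euler_char_def num_faces_alt)
qed

lemma connected_component_subgraph:
  assumes wf: "wf_graph \<gamma>" and i: "i < num_vertices \<gamma>"
  shows "connected_graph (subgraph_on \<gamma> (component_of \<gamma> i))"
proof (rule connected_graphI)
  let ?S = "component_of \<gamma> i" and ?sub = "subgraph_on \<gamma> (component_of \<gamma> i)"
  interpret closed_subgraph \<gamma> ?S
    by unfold_locales (fact wf adjacency_closed_component)+
  \<comment> \<open>The increasing list of vertices of the component translates positions in the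
    subgraph into vertex labels of \<open>\<gamma>\<close>. Being distinct, it also translates
    back.\<close>
  define ks where "ks = filter (\<lambda>k. k \<in> ?S) [0..<num_vertices \<gamma>]"
  have ks: "distinct ks" "set ks = ?S" using S_less by (auto simp: ks_def)
  have rot: "rotations ?sub = map ((!) (rotations \<gamma>)) ks"
    by (simp add: rotations_sub nths_alt ks_def num_vertices_def)
  then have n: "num_vertices ?sub = length ks" by (simp add: num_vertices_def)
  fix U assume U: "adjacency_closed ?sub U" "U \<noteq> {}"
  have U_less: "u < length ks" if "u \<in> U" for u using U(1) that n by (auto simp: adjacency_closed_def)
  define W where "W = (!) ks ` U"
  have W: "adjacency_closed \<gamma> W"
    unfolding adjacency_closed_def
  proof (intro conjI allI impI)
    show "W \<subseteq> {..<num_vertices \<gamma>}" using U_less S_less ks(2) by (force simp: W_def)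
    fix k l assume kl: "(k, l) \<in> adjacency \<gamma>" and "k \<in> W"
    then obtain u where u: "u \<in> U" "k = ks ! u" by (auto simp: W_def)
    then have "k \<in> ?S" using U_less ks(2) by auto
    then have "l \<in> ?S" using kl closed by (auto simp: adjacency_closed_def)
    then obtain v where v: "v < length ks" "l = ks ! v" using ks(2) by (metis in_set_conv_nth)
    obtain x where x: "x \<in> set (rotations \<gamma> ! k)" "mate \<gamma> x \<in> set (rotations \<gamma> ! l)"
      using kl by (auto simp: adjacency_def)
    have "x \<in> half_edges ?sub" using x \<open>k \<in> ?S\<close> unfolding half_edges_sub by blast
    then have "(u, v) \<in> adjacency ?sub"
      using u v x U_less by (intro adjacencyI[of _ _ _ x]) (simp_all add: n rot mate_sub(1))
    then have "v \<in> U" using U(1) u by (auto simp: adjacency_closed_def)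
    with v show "l \<in> W" by (simp add: W_def)
  qed
  \<comment> \<open>Reachability is symmetric, so any vertex of the component found in the closed
    set \<open>W\<close> brings \<open>i\<close>, and with it the whole component, into
    \<open>W\<close>.\<close>
  obtain k where k: "k \<in> W" "k \<in> ?S" using U(2) U_less ks(2) by (force simp: W_def)
  have "i \<in> W"
    using k(2) symD[OF sym_adjacency_rtrancl[OF wf], of i k] adjacency_closed_rtrancl[OF W _ k(1), of i]
    by (auto simp: component_of_def)
  then have "?S \<subseteq> W" using adjacency_closed_rtrancl[OF W] by (auto simp: component_of_def)
  have "u \<in> U" if u: "u < length ks" for u
  proof -
    have "ks ! u \<in> W" using \<open>?S \<subseteq> W\<close> ks(2) u by auto
    then obtain v where "v \<in> U" "ks ! u = ks ! v" by (auto simp: W_def)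
    then show ?thesis using ks(1) u U_less nth_eq_iff_index_eq by metis
  qed
  then show "U = {..<num_vertices ?sub}" using U_less n by auto
qed

lemma euler_char_contracts_edge:
  assumes "wf_graph \<gamma>" "contracts_edge \<gamma> i j \<gamma>'"
  shows "wf_graph \<gamma>'" "euler_char \<gamma>' = euler_char \<gamma>" "num_vertices \<gamma> = Suc (num_vertices \<gamma>')"
    "num_vertices \<gamma>' \<ge> 1" "card (half_edges \<gamma>') < card (half_edges \<gamma>)"
proof -
  obtain h as bs where "edge_removal \<gamma> \<gamma>' h" and faces: "num_faces \<gamma> = num_faces \<gamma>'"
    and ij: "i < j" "j < num_vertices \<gamma>" "rotations \<gamma>' = remove_nth j ((rotations \<gamma>)[i := as @ bs])"
    using contracts_edge_removal[OF assms] by blast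
  then interpret edge_removal \<gamma> \<gamma>' h by simp
  have "num_vertices \<gamma>' = num_vertices \<gamma> - 1"
    using ij by (simp add: num_vertices_def length_remove_nth)
  with ij show "num_vertices \<gamma> = Suc (num_vertices \<gamma>')" "num_vertices \<gamma>' \<ge> 1" by simp_all
  then show "euler_char \<gamma>' = euler_char \<gamma>" using faces card_edges by (simp add: euler_char_def)
  show "wf_graph \<gamma>'" "card (half_edges \<gamma>') < card (half_edges \<gamma>)"
    by (rule wf' card_half_edges_less)+
qed

text \<open>One vertex is gained and one edge is lost while the faces stay, which gives 2; for a
  joining edge the vertex and the edge are both lost and cancel.\<close>

lemma euler_char_contracts_loop:
  assumes "wf_graph \<gamma>" "contracts_loop \<gamma> i \<gamma>'"
  shows "wf_graph \<gamma>'" "euler_char \<gamma>' = euler_char \<gamma> + 2" "num_vertices \<gamma>' = Suc (num_vertices \<gamma>)"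
    "i < num_vertices \<gamma>" "card (half_edges \<gamma>') < card (half_edges \<gamma>)"
proof -
  obtain h as bs where "edge_removal \<gamma> \<gamma>' h" and faces: "num_faces \<gamma> = num_faces \<gamma>'"
    and i: "i < num_vertices \<gamma>"
    and rot: "rotations \<gamma>' = take i (rotations \<gamma>) @ [as, bs] @ drop (Suc i) (rotations \<gamma>)"
    using contracts_loop_removal[OF assms] by blast
  then interpret edge_removal \<gamma> \<gamma>' h by simp
  show "num_vertices \<gamma>' = Suc (num_vertices \<gamma>)" using i rot by (simp add: num_vertices_def)
  then show "euler_char \<gamma>' = euler_char \<gamma> + 2" using faces card_edges by (simp add: euler_char_def)
  show "i < num_vertices \<gamma>" "wf_graph \<gamma>'" "card (half_edges \<gamma>') < card (half_edges \<gamma>)"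
    by (rule i wf' card_half_edges_less)+
qed

section \<open>Induction along contractions and the genus\<close>

lemma cyclically_equal_refl: "cyclically_equal xs xs"
  unfolding cyclically_equal_def by (rule exI[of _ 0]) simp

lemma cyclically_equal_split: "cyclically_equal (us @ x # vs) (x # vs @ us)"
  unfolding cyclically_equal_def by (rule exI[of _ "length us"]) (simp add: rotate_append)

text \<open>Literal equality holds, not merely isomorphism, because a permutation of the empty set
  is the identity. Hence ECA 0, stated for this one graph, can start the induction.\<close>

lemma edgeless_connected_graph:
  assumes wf: "wf_graph \<gamma>" and conn: "connected_graph \<gamma>" and n: "num_vertices \<gamma> \<ge> 1"
    and empty: "half_edges \<gamma> = {}"
  shows "\<gamma> = point_graph"
proof -
  have "adjacency \<gamma> = {}" using empty half_edgesI by (fastforce simp: adjacency_def)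
  moreover have "num_vertices \<gamma> \<ge> 2 \<Longrightarrow> (0, 1) \<in> (adjacency \<gamma>)\<^sup>*"
    using conn by (simp add: connected_graph_def)
  ultimately have "num_vertices \<gamma> = 1" using n by fastforce
  then obtain r where r: "rotations \<gamma> = [r]" by (auto simp: num_vertices_def length_Suc_conv)
  then have "r = []" using empty by (simp add: half_edges_def)
  moreover have "mate \<gamma> = id" using wf empty by (simp add: wf_graph_def)
  ultimately show ?thesis using r by (simp add: point_graph_def)
qed

lemma contraction_exists:
  assumes wf: "wf_graph \<gamma>" and ne: "half_edges \<gamma> \<noteq> {}"
  shows "(\<exists>i j \<gamma>'. contracts_edge \<gamma> i j \<gamma>') \<or> (\<exists>i \<gamma>'. contracts_loop \<gamma> i \<gamma>')"
proof -
  obtain x where x: "x \<in> half_edges \<gamma>" using ne by auto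
  then have m: "mate \<gamma> x \<in> half_edges \<gamma>" "mate \<gamma> (mate \<gamma> x) = x" "mate \<gamma> x \<noteq> x"
    using wf by (auto simp: wf_graph_def permutes_in_image)
  have edge: "\<exists>i j \<gamma>'. contracts_edge \<gamma> i j \<gamma>'"
    if kl: "k < l" "l < num_vertices \<gamma>" "x \<in> set (rotations \<gamma> ! k)" "mate \<gamma> x \<in> set (rotations \<gamma> ! l)" for x k l
  proof -
    obtain us vs where "rotations \<gamma> ! k = us @ x # vs" using kl(3) by (meson split_list)
    moreover obtain us' vs' where "rotations \<gamma> ! l = us' @ mate \<gamma> x # vs'" using kl(4) by (meson split_list)
    ultimately show ?thesis using kl(1,2) cyclically_equal_split unfolding contracts_edge_def by metis
  qed
  obtain k where k: "k < num_vertices \<gamma>" "x \<in> set (rotations \<gamma> ! k)" using half_edge_at[OF x] .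
  obtain l where l: "l < num_vertices \<gamma>" "mate \<gamma> x \<in> set (rotations \<gamma> ! l)" using half_edge_at[OF m(1)] .
  consider "k < l" | "l < k" | "k = l" by linarith
  then show ?thesis
  proof cases
    case 1 then show ?thesis using edge k l by blast
  next
    case 2 then show ?thesis using edge[of l k "mate \<gamma> x"] k l m by auto
  next
    case 3
    obtain us vs where split: "rotations \<gamma> ! k = us @ x # vs" using k(2) by (meson split_list)
    \<comment> \<open>Read cyclically from \<open>x\<close> on, the rather symmetric rotation
      becomes \<open>x # vs @ us\<close>, and the other half of the loop lies in the rest.\<close>
    then have "mate \<gamma> x \<in> set (vs @ us)" using l(2) 3 m(3) by auto
    then obtain as bs where "vs @ us = as @ mate \<gamma> x # bs" by (meson split_list)
    then have "cyclically_equal (rotations \<gamma> ! k) (x # as @ mate \<gamma> x # bs)"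
      using cyclically_equal_split[of us x vs] by (simp add: split)
    then show ?thesis using k(1) unfolding contracts_loop_def by blast
  qed
qed

text \<open>Half-edges strictly decrease under contraction, and a component has at most as many as
  the whole graph, so both components of a separated graph are covered. The rule serves twice: for
  the existence of the genus and for the evaluation of an assignment.\<close>

lemma connected_graph_induct [consumes 3, case_names point edge loop_connected loop_disconnected]:
  assumes "wf_graph \<gamma>" "connected_graph \<gamma>" "num_vertices \<gamma> \<ge> 1"
    and point: "P point_graph"
    and edge: "\<And>\<gamma> i j \<gamma>'. wf_graph \<gamma> \<Longrightarrow> connected_graph \<gamma> \<Longrightarrow> contracts_edge \<gamma> i j \<gamma>' \<Longrightarrow>
      P \<gamma>' \<Longrightarrow> P \<gamma>"
    and loop_connected: "\<And>\<gamma> i \<gamma>'. wf_graph \<gamma> \<Longrightarrow> connected_graph \<gamma> \<Longrightarrow> contracts_loop \<gamma> i \<gamma>' \<Longrightarrow>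
      connected_graph \<gamma>' \<Longrightarrow> P \<gamma>' \<Longrightarrow> P \<gamma>"
    and loop_disconnected: "\<And>\<gamma> i \<gamma>'. wf_graph \<gamma> \<Longrightarrow> connected_graph \<gamma> \<Longrightarrow> contracts_loop \<gamma> i \<gamma>' \<Longrightarrow>
      \<not> connected_graph \<gamma>' \<Longrightarrow> P (subgraph_on \<gamma>' (component_of \<gamma>' i)) \<Longrightarrow>
      P (subgraph_on \<gamma>' (component_of \<gamma>' (Suc i))) \<Longrightarrow> P \<gamma>"
  shows "P \<gamma>"
  using assms(1-3)
proof (induction "card (half_edges \<gamma>)" arbitrary: \<gamma> rule: less_induct)
  case less
  note wf = less.prems(1) and conn = less.prems(2)
  consider "half_edges \<gamma> = {}" | i j \<gamma>' where "contracts_edge \<gamma> i j \<gamma>'" | i \<gamma>' where "contracts_loop \<gamma> i \<gamma>'"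
    using contraction_exists[OF wf] by blast
  then show ?case
  proof cases
    case 1
    then have "\<gamma> = point_graph" using less.prems by (intro edgeless_connected_graph)
    with point show ?thesis by simp
  next
    case 2
    note e = euler_char_contracts_edge[OF wf 2]
    have "P \<gamma>'" by (rule less.hyps[OF e(5,1) connected_contracts_edge[OF wf conn 2] e(4)])
    with edge[OF wf conn 2] show ?thesis .
  next
    case 3
    note e = euler_char_contracts_loop[OF wf 3]
    show ?thesis
    proof (cases "connected_graph \<gamma>'")
      case True
      have "P \<gamma>'" by (rule less.hyps[OF e(5,1) True]) (simp add: e(3))
      with loop_connected[OF wf conn 3 True] show ?thesis .
    next
      case False
      note comp = contracts_loop_components[OF wf conn 3 False]
      have "P (subgraph_on \<gamma>' (component_of \<gamma>' k))" if k: "k < num_vertices \<gamma>'" for k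
      proof (rule less.hyps)
        interpret closed_subgraph \<gamma>' "component_of \<gamma>' k"
          by unfold_locales (fact e(1) adjacency_closed_component)+
        show "wf_graph (subgraph_on \<gamma>' (component_of \<gamma>' k))" by (rule wf_sub)
        show "connected_graph (subgraph_on \<gamma>' (component_of \<gamma>' k))"
          by (rule connected_component_subgraph[OF e(1) k])
        show "card (half_edges (subgraph_on \<gamma>' (component_of \<gamma>' k))) < card (half_edges \<gamma>)"
          using card_mono[OF finite_half_edges half_edges_sub_subset] e(5) by linarith
        have "set (rotations (subgraph_on \<gamma>' (component_of \<gamma>' k))) \<noteq> {}"
          unfolding rotations_sub set_nths using k by (auto simp: component_of_def num_vertices_def)
        then show "num_vertices (subgraph_on \<gamma>' (component_of \<gamma>' k)) \<ge> 1"
          by (simp add: num_vertices_def Suc_le_eq)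
      qed
      with loop_disconnected[OF wf conn 3 False] e(3,4) show ?thesis by simp
    qed
  qed
qed

section \<open>The genus of a connected graph and the types of its contractions\<close>

lemma euler_char_point: "euler_char point_graph = 2"
  by (simp add: euler_char_def num_faces_alt num_vertices_def edges_alt half_edges_def point_graph_def)

lemma euler_char_loop_components:
  assumes wf: "wf_graph \<gamma>" and conn: "connected_graph \<gamma>" and contracts: "contracts_loop \<gamma> i \<gamma>'"
    and disc: "\<not> connected_graph \<gamma>'"
  shows "euler_char \<gamma> + 2 = euler_char (subgraph_on \<gamma>' (component_of \<gamma>' i)) +
    euler_char (subgraph_on \<gamma>' (component_of \<gamma>' (Suc i)))"
proof -
  note e = euler_char_contracts_loop[OF wf contracts]
  show ?thesis
    using euler_char_components[OF e(1) adjacency_closed_component adjacency_closed_component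
        contracts_loop_components(1,2)[OF wf conn contracts disc]] e(2)
    by simp
qed

text \<open>Going back through a contraction, a joining edge keeps the genus and a loop whose
  contraction stays connected adds one. If the contraction separates, the genera add up, since (2 -
  2g1) + (2 - 2g2) exceeds the old Euler characteristic by 2.\<close>

lemma genus_exists:
  assumes "wf_graph \<gamma>" "connected_graph \<gamma>" "num_vertices \<gamma> \<ge> 1"
  shows "\<exists>g. euler_char \<gamma> = 2 - 2 * int g"
  using assms
proof (induction rule: connected_graph_induct)
  case point
  show ?case by (simp add: euler_char_point)
next
  case (edge \<gamma> i j \<gamma>')
  then show ?case using euler_char_contracts_edge(2)[OF edge(1,3)] by simp
next
  case (loop_connected \<gamma> i \<gamma>')
  then obtain g where "euler_char \<gamma>' = 2 - 2 * int g" by blast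
  then have "euler_char \<gamma> = 2 - 2 * int (Suc g)"
    using euler_char_contracts_loop(2)[OF loop_connected(1,3)] by simp
  then show ?case by blast
next
  case (loop_disconnected \<gamma> i \<gamma>')
  then obtain g1 g2 where "euler_char (subgraph_on \<gamma>' (component_of \<gamma>' i)) = 2 - 2 * int g1"
    "euler_char (subgraph_on \<gamma>' (component_of \<gamma>' (Suc i))) = 2 - 2 * int g2" by blast
  then have "euler_char \<gamma> = 2 - 2 * int (g1 + g2)"
    using euler_char_loop_components[OF loop_disconnected(1-4)] by simp
  then show ?case by blast
qed

lemma contracts_edge_cell_graphs:
  assumes "\<gamma> \<in> cell_graphs g n" "contracts_edge \<gamma> i j \<gamma>'"
  shows "\<gamma>' \<in> cell_graphs g (n - 1)"
  using assms euler_char_contracts_edge[of \<gamma> i j \<gamma>'] connected_contracts_edge[of \<gamma> i j \<gamma>']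
  by (auto simp: cell_graphs_iff)

text \<open>The contracted graph has Euler characteristic 4 - 2g, and this equals 2 - 2g' with g' a
  natural number; so g is positive, and a loop of a genus 0 graph always separates.\<close>

lemma contracts_loop_cell_graphs:
  assumes \<gamma>: "\<gamma> \<in> cell_graphs g n" and contracts: "contracts_loop \<gamma> i \<gamma>'" and conn: "connected_graph \<gamma>'"
  obtains g' where "g = Suc g'" "\<gamma>' \<in> cell_graphs g' (Suc n)"
proof -
  have wf: "wf_graph \<gamma>" and "euler_char \<gamma> = 2 - 2 * int g" "num_vertices \<gamma> = n"
    using \<gamma> by (auto simp: cell_graphs_iff)
  note e = euler_char_contracts_loop[OF wf contracts]
  obtain g' where "euler_char \<gamma>' = 2 - 2 * int g'" using genus_exists[OF e(1) conn] e(3) by auto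
  then show thesis using that[of g'] conn e(1-3) \<open>euler_char \<gamma> = _\<close> \<open>num_vertices \<gamma> = n\<close>
    by (simp add: cell_graphs_iff)
qed

lemma component_cell_graphs:
  assumes wf: "wf_graph \<gamma>" and i: "i < num_vertices \<gamma>"
  obtains g where "subgraph_on \<gamma> (component_of \<gamma> i) \<in> cell_graphs g (card (component_of \<gamma> i))"
proof -
  let ?S = "component_of \<gamma> i"
  interpret closed_subgraph \<gamma> ?S
    by unfold_locales (fact wf adjacency_closed_component)+
  have S: "{k. k < length (rotations \<gamma>) \<and> k \<in> ?S} = ?S" using S_less by (auto simp: num_vertices_def)
  have n: "num_vertices (subgraph_on \<gamma> ?S) = card ?S"
    by (simp add: num_vertices_def rotations_sub length_nths S)
  have "i \<in> ?S" using i by (simp add: component_of_def)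
  moreover have "finite ?S" using S_less by (auto simp: component_of_def)
  ultimately have "card ?S \<ge> 1" by (auto simp: Suc_le_eq card_gt_0_iff)
  with genus_exists[OF wf_sub connected_component_subgraph[OF wf i]] that n show thesis
    using wf_sub connected_component_subgraph[OF wf i] by (auto simp: cell_graphs_iff)
qed

lemma contracts_loop_disconnected_cell_graphs:
  assumes \<gamma>: "\<gamma> \<in> cell_graphs g n" and contracts: "contracts_loop \<gamma> i \<gamma>'" and disc: "\<not> connected_graph \<gamma>'"
  obtains g1 g2 where "g = g1 + g2"
    "subgraph_on \<gamma>' (component_of \<gamma>' i) \<in> cell_graphs g1 (card (component_of \<gamma>' i))"
    "subgraph_on \<gamma>' (component_of \<gamma>' (Suc i)) \<in> cell_graphs g2 (card (component_of \<gamma>' (Suc i)))"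
proof -
  have wf: "wf_graph \<gamma>" and conn: "connected_graph \<gamma>" and g: "euler_char \<gamma> = 2 - 2 * int g"
    using \<gamma> by (auto simp: cell_graphs_iff)
  note e = euler_char_contracts_loop[OF wf contracts]
  obtain g1 where g1: "subgraph_on \<gamma>' (component_of \<gamma>' i) \<in> cell_graphs g1 (card (component_of \<gamma>' i))"
    using component_cell_graphs[OF e(1), of i] e(3,4) by auto
  obtain g2 where g2:
      "subgraph_on \<gamma>' (component_of \<gamma>' (Suc i)) \<in> cell_graphs g2 (card (component_of \<gamma>' (Suc i)))"
    using component_cell_graphs[OF e(1), of "Suc i"] e(3,4) by auto
  have "g = g1 + g2"
    using euler_char_loop_components[OF wf conn contracts disc] g g1 g2 by (simp add: cell_graphs_iff)
  with g1 g2 that show thesis by blast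
qed

section \<open>Existence of a cell graph of every type\<close>

lemma half_edges_bounded:
  obtains N where "\<And>x. x \<in> half_edges \<gamma> \<Longrightarrow> x < N"
  using finite_nat_set_iff_bounded[of "half_edges \<gamma>"] by auto

text \<open>
  Larger cell graphs are built by adding fresh half-edges such that contractions lead back to the
  given graph; the Euler characteristic is then read off from the contraction.
\<close>

lemma cell_graphs_add_leaf:
  assumes "\<gamma> \<in> cell_graphs g n"
  shows "cell_graphs g (Suc n) \<noteq> {}"
proof -
  have wf: "wf_graph \<gamma>" and conn: "connected_graph \<gamma>" and n: "num_vertices \<gamma> = n" "n \<ge> 1"
    and g: "euler_char \<gamma> = 2 - 2 * int g"
    using assms by (auto simp: cell_graphs_iff)
  obtain N where N: "\<And>x. x \<in> half_edges \<gamma> \<Longrightarrow> x < N" using half_edges_bounded[of \<gamma>] by blast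
  obtain r rs where rot: "rotations \<gamma> = r # rs" using n by (cases "rotations \<gamma>") (auto simp: num_vertices_def)
  \<comment> \<open>A pendant edge with one half at vertex 0 and the other alone at a new vertex.
    The new vertex comes last, so contracting towards 0 shifts no label and appends the empty list
    to \<open>r\<close>, which restores \<open>\<gamma>\<close> exactly.\<close>
  define \<gamma>2 where "\<gamma>2 = \<lparr>rotations = (N # r) # rs @ [[Suc N]], mate = (mate \<gamma>)(N := Suc N, Suc N := N)\<rparr>"
  have mate2: "mate \<gamma>2 = (mate \<gamma>)(N := Suc N, Suc N := N)" by (simp add: \<gamma>2_def)
  have H2: "half_edges \<gamma>2 = insert N (insert (Suc N) (half_edges \<gamma>))"
    by (auto simp: half_edges_def \<gamma>2_def rot)
  have fresh: "N \<notin> half_edges \<gamma>" "Suc N \<notin> half_edges \<gamma>" using N by fastforce+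
  have m: "mate \<gamma> x \<in> half_edges \<gamma>" "mate \<gamma> (mate \<gamma> x) = x" "mate \<gamma> x \<noteq> x" if "x \<in> half_edges \<gamma>" for x
    using that wf by (auto simp: wf_graph_def permutes_in_image)
  have out: "mate \<gamma> x = x" if "x \<notin> half_edges \<gamma>" for x
    using that wf by (auto simp: wf_graph_def permutes_not_in)
  have m2: "mate \<gamma>2 x \<in> half_edges \<gamma>2 \<and> mate \<gamma>2 (mate \<gamma>2 x) = x \<and> mate \<gamma>2 x \<noteq> x" if "x \<in> half_edges \<gamma>2" for x
    using that m[of x] fresh by (auto simp: H2 mate2)
  have "mate \<gamma>2 permutes half_edges \<gamma>2"
    by (rule involution_permutes) (use m2 out in \<open>auto simp: H2 mate2\<close>)
  moreover have "distinct (concat (rotations \<gamma>2))"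
    using wf fresh by (auto simp: \<gamma>2_def wf_graph_def rot half_edges_def)
  ultimately have wf2: "wf_graph \<gamma>2" using m2 by (simp add: wf_graph_def)
  have n2: "num_vertices \<gamma>2 = Suc n" using n(1) by (simp add: \<gamma>2_def num_vertices_def rot)
  have contracts: "contracts_edge \<gamma>2 0 n \<gamma>"
    unfolding contracts_edge_def
  proof (intro conjI exI)
    have len: "n = Suc (length rs)" using n(1) by (simp add: num_vertices_def rot)
    show "cyclically_equal (rotations \<gamma>2 ! 0) (N # r)" by (simp add: \<gamma>2_def cyclically_equal_refl)
    show "cyclically_equal (rotations \<gamma>2 ! n) (mate \<gamma>2 N # [])"
      by (simp add: \<gamma>2_def len nth_append cyclically_equal_refl)
    have "mate_without \<gamma>2 N = mate \<gamma>" using fresh out by (auto simp: mate_without_def \<gamma>2_def)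
    then show "\<gamma> = \<lparr>rotations = remove_nth n ((rotations \<gamma>2)[0 := r @ []]), mate = mate_without \<gamma>2 N\<rparr>"
      using rot by (cases \<gamma>) (simp add: \<gamma>2_def len remove_nth_def)
  qed (use n n2 in auto)
  have at: "set (rotations \<gamma> ! k) \<subseteq> set (rotations \<gamma>2 ! k)" if "k < n" for k
    using that n(1) by (cases k) (auto simp: \<gamma>2_def rot num_vertices_def nth_append)
  have sub: "adjacency \<gamma> \<subseteq> adjacency \<gamma>2"
  proof clarify
    fix k l assume "(k, l) \<in> adjacency \<gamma>"
    then obtain x where x: "k < n" "l < n" "x \<in> set (rotations \<gamma> ! k)" "mate \<gamma> x \<in> set (rotations \<gamma> ! l)"
      using n(1) by (auto simp: adjacency_def)
    then have "x \<in> half_edges \<gamma>" using n(1) by (intro half_edgesI) simp_all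
    then have "mate \<gamma>2 x = mate \<gamma> x" using fresh by (auto simp: \<gamma>2_def)
    then show "(k, l) \<in> adjacency \<gamma>2"
      using x at n2 by (intro adjacencyI[of _ _ _ x]) auto
  qed
  have from0: "(0, k) \<in> (adjacency \<gamma>2)\<^sup>*" if "k < Suc n" for k
  proof (cases "k = n")
    case True
    have "(0, n) \<in> adjacency \<gamma>2"
      using n by (intro adjacencyI[of _ _ _ N]) (auto simp: n2 \<gamma>2_def nth_append num_vertices_def rot)
    with True show ?thesis by blast
  next
    case False
    then have "(0, k) \<in> (adjacency \<gamma>)\<^sup>*" using conn that n by (simp add: connected_graph_def)
    then show ?thesis using rtrancl_mono[OF sub] by blast
  qed
  have "connected_graph \<gamma>2"
    unfolding connected_graph_def n2
  proof (intro allI impI)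
    fix i j assume "i < Suc n" "j < Suc n"
    then show "(i, j) \<in> (adjacency \<gamma>2)\<^sup>*"
      using symD[OF sym_adjacency_rtrancl[OF wf2] from0[of i]] from0[of j] by (simp add: rtrancl_trans)
  qed
  then have "\<gamma>2 \<in> cell_graphs g (Suc n)"
    using wf2 n2 g euler_char_contracts_edge(2)[OF wf2 contracts] by (simp add: cell_graphs_iff)
  then show ?thesis by blast
qed

text \<open>Two interlaced loops, \<open>N\<close> with \<open>N + 2\<close> and
  \<open>N + 1\<close> with \<open>N + 3\<close>, are inserted at the only vertex, as in the
  one-face cell graph of the torus. Contracting the first loop puts the halves of the second at
  different vertices, so that it becomes a joining edge; contracting that edge returns
  \<open>\<gamma>\<close>. Only the loop changes the Euler characteristic, so the genus differs by
  one.\<close>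

lemma cell_graphs_add_handle:
  assumes "\<gamma> \<in> cell_graphs g 1"
  shows "cell_graphs (Suc g) 1 \<noteq> {}"
proof -
  have wf: "wf_graph \<gamma>" and n: "num_vertices \<gamma> = 1" and g: "euler_char \<gamma> = 2 - 2 * int g"
    using assms by (auto simp: cell_graphs_iff)
  obtain N where N: "\<And>x. x \<in> half_edges \<gamma> \<Longrightarrow> x < N" using half_edges_bounded[of \<gamma>] by blast
  obtain r where rot: "rotations \<gamma> = [r]" using n by (auto simp: num_vertices_def length_Suc_conv)
  define \<gamma>2 where "\<gamma>2 = \<lparr>rotations = [N # [N + 1] @ (N + 2) # (N + 3) # r],
    mate = (mate \<gamma>)(N := N + 2, N + 2 := N, N + 1 := N + 3, N + 3 := N + 1)\<rparr>"
  define \<gamma>1 where "\<gamma>1 = \<lparr>rotations = [[N + 1], (N + 3) # r], mate = mate_without \<gamma>2 N\<rparr>"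
  have mate2: "mate \<gamma>2 = (mate \<gamma>)(N := N + 2, N + 2 := N, N + 1 := N + 3, N + 3 := N + 1)"
    by (simp add: \<gamma>2_def)
  have H2: "half_edges \<gamma>2 = {N, N + 1, N + 2, N + 3} \<union> half_edges \<gamma>"
    by (auto simp: half_edges_def \<gamma>2_def rot)
  have fresh: "N + k \<notin> half_edges \<gamma>" for k using N by fastforce
  have fresh': "N \<notin> half_edges \<gamma>" using fresh[of 0] by simp
  have m: "mate \<gamma> x \<in> half_edges \<gamma>" "mate \<gamma> (mate \<gamma> x) = x" "mate \<gamma> x \<noteq> x" if "x \<in> half_edges \<gamma>" for x
    using that wf by (auto simp: wf_graph_def permutes_in_image)
  have out: "mate \<gamma> x = x" if "x \<notin> half_edges \<gamma>" for x
    using that wf by (auto simp: wf_graph_def permutes_not_in)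
  have m2: "mate \<gamma>2 x \<in> half_edges \<gamma>2 \<and> mate \<gamma>2 (mate \<gamma>2 x) = x \<and> mate \<gamma>2 x \<noteq> x" if "x \<in> half_edges \<gamma>2" for x
  proof (cases "x \<in> half_edges \<gamma>")
    case True
    have "x \<noteq> N + k" "mate \<gamma> x \<noteq> N + k" for k using True m(1)[OF True] fresh by metis+
    from this[of 0] this[of 1] this[of 2] this[of 3] show ?thesis using m[OF True] by (simp add: H2 mate2)
  next
    case False
    with that show ?thesis by (auto simp: H2 mate2)
  qed
  have "mate \<gamma>2 permutes half_edges \<gamma>2"
    by (rule involution_permutes) (use m2 out in \<open>auto simp: H2 mate2\<close>)
  moreover have "distinct (concat (rotations \<gamma>2))"
    using wf fresh[of 1] fresh[of 2] fresh[of 3] fresh' by (simp add: \<gamma>2_def wf_graph_def rot half_edges_def)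
  ultimately have wf2: "wf_graph \<gamma>2" using m2 by (simp add: wf_graph_def)
  have loop: "contracts_loop \<gamma>2 0 \<gamma>1"
    unfolding contracts_loop_def
  proof (intro conjI exI)
    show "cyclically_equal (rotations \<gamma>2 ! 0) (N # [N + 1] @ mate \<gamma>2 N # (N + 3) # r)"
      by (simp add: \<gamma>2_def cyclically_equal_refl)
  qed (simp_all add: \<gamma>1_def \<gamma>2_def num_vertices_def)
  note e2 = euler_char_contracts_loop[OF wf2 loop]
  have edge: "contracts_edge \<gamma>1 0 1 \<gamma>"
    unfolding contracts_edge_def
  proof (intro conjI exI)
    have mate1: "mate \<gamma>1 (N + 1) = N + 3" by (simp add: \<gamma>1_def \<gamma>2_def mate_without_def)
    show "cyclically_equal (rotations \<gamma>1 ! 0) ((N + 1) # [])" by (simp add: \<gamma>1_def cyclically_equal_refl)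
    show "cyclically_equal (rotations \<gamma>1 ! 1) (mate \<gamma>1 (N + 1) # r)"
      unfolding mate1 by (simp add: \<gamma>1_def cyclically_equal_refl)
    have "mate \<gamma> (N + k) = N + k" for k by (rule out[OF fresh])
    from this[of 0] this[of 1] this[of 2] this[of 3]
    have "mate_without \<gamma>1 (N + 1) = mate \<gamma>"
      unfolding mate_without_def mate1 by (auto simp: \<gamma>1_def \<gamma>2_def mate_without_def)
    then show "\<gamma> = \<lparr>rotations = remove_nth 1 ((rotations \<gamma>1)[0 := [] @ r]), mate = mate_without \<gamma>1 (N + 1)\<rparr>"
      using rot by (cases \<gamma>) (simp add: \<gamma>1_def remove_nth_def)
  qed (simp_all add: \<gamma>1_def num_vertices_def)
  have "euler_char \<gamma>2 = 2 - 2 * int (Suc g)"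
    using g e2(2) euler_char_contracts_edge(2)[OF e2(1) edge] by simp
  moreover have "num_vertices \<gamma>2 = 1" by (simp add: \<gamma>2_def num_vertices_def)
  moreover from this have "connected_graph \<gamma>2" by (simp add: connected_graph_def)
  ultimately have "\<gamma>2 \<in> cell_graphs (Suc g) 1" using wf2 by (simp add: cell_graphs_iff)
  then show ?thesis by blast
qed

lemma point_graph_in_cell_graphs: "point_graph \<in> cell_graphs 0 1"
  by (simp add: cell_graphs_iff euler_char_point)
    (simp add: wf_graph_def connected_graph_def num_vertices_def half_edges_def point_graph_def)

text \<open>Handles are added while there is a single vertex, where connectivity is automatic;
  leaves then raise the number of vertices at fixed genus.\<close>

lemma cell_graphs_nonempty:
  assumes "n \<ge> 1"
  shows "cell_graphs g n \<noteq> {}"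
  using assms
proof (induction n rule: dec_induct)
  case base
  show ?case
    by (induction g) (use point_graph_in_cell_graphs cell_graphs_add_handle in auto)
qed (use cell_graphs_add_leaf in blast)

text \<open>An assignment receives a graph without its type, so the genus has to be a function of
  the graph alone. It is meaningful on connected cell graphs.\<close>

definition genus :: "cell_graph \<Rightarrow> nat" where
  "genus \<gamma> = nat ((2 - euler_char \<gamma>) div 2)"

lemma genus_eq: "\<gamma> \<in> cell_graphs g n \<Longrightarrow> genus \<gamma> = g"
  by (simp add: genus_def cell_graphs_iff)

section \<open>Frobenius algebras\<close>

context frobenius_algebra
begin

section \<open>Bilinearity and the inverse Gram matrix\<close>

lemma eta_sum_right: "\<eta> u (sum f S) = (\<Sum>x\<in>S. \<eta> u (f x))"
proof -
  interpret l: Vector_Spaces.linear scale "(*)" "\<eta> u" by (rule eta_linear)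
  show ?thesis by (rule l.sum)
qed

lemma eta_scale_right: "\<eta> u (scale c v) = c * \<eta> u v"
proof -
  interpret l: Vector_Spaces.linear scale "(*)" "\<eta> u" by (rule eta_linear)
  show ?thesis by (rule l.scale)
qed

lemma eta_add_right: "\<eta> u (v + w) = \<eta> u v + \<eta> u w"
proof -
  interpret l: Vector_Spaces.linear scale "(*)" "\<eta> u" by (rule eta_linear)
  show ?thesis by (rule l.add)
qed

lemma eta_diff_left: "\<eta> (u - w) v = \<eta> u v - \<eta> w v"
proof -
  interpret l: Vector_Spaces.linear scale "(*)" "\<eta> v" by (rule eta_linear)
  show ?thesis using l.diff[of u w] by (simp add: eta_sym[of v])
qed

lemma eta_sum_left: "\<eta> (sum f S) v = (\<Sum>x\<in>S. \<eta> (f x) v)"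
  using eta_sum_right[of v f S] by (simp add: eta_sym[of v])

lemma eta_add_left: "\<eta> (u + w) v = \<eta> u v + \<eta> w v"
  using eta_add_right[of v u w] by (simp add: eta_sym[of v])

lemma eta_scale_left: "\<eta> (scale c u) v = c * \<eta> u v"
  using eta_scale_right[of v c u] by (simp add: eta_sym[of v])

lemma counit_mult: "counit (u * v) = \<eta> u v"
  by (simp add: counit_def eta_mult)

lemma eta_eqI:
  assumes "\<And>k. k \<in> Basis \<Longrightarrow> \<eta> u k = \<eta> v k"
  shows "u = v"
proof -
  have "\<eta> (u - v) w = 0" for w
  proof -
    have "w \<in> span Basis" by (simp add: span_Basis)
    then obtain c where "w = (\<Sum>k\<in>Basis. scale (c k) k)"
      by (auto simp: span_finite[OF finite_Basis])
    then show ?thesis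
      by (simp add: eta_sum_right eta_scale_right eta_diff_left assms)
  qed
  then have "u - v = 0" by (rule eta_nondegenerate)
  then show ?thesis by simp
qed

text \<open>The map \<open>T\<close> sends a vector to the one whose coordinates are its pairings
  with the basis. It is injective by non-degeneracy, hence surjective in finite dimension, and a
  preimage of \<open>i\<close> is the dual vector.\<close>

lemma ex_dual_vector: "\<exists>d. \<forall>k\<in>Basis. \<eta> d k = (if i = k then 1 else 0)" if "i \<in> Basis"
proof -
  define T where "T v = (\<Sum>j\<in>Basis. scale (\<eta> v j) j)" for v
  interpret T: Vector_Spaces.linear scale scale T
    by unfold_locales (simp_all add: T_def eta_add_left eta_scale_left scale_left_distrib sum.distrib
        scale_sum_right)
  have coeff: "(\<Sum>j\<in>Basis. scale (c j) j) = (\<Sum>j\<in>Basis. scale (c' j) j) \<Longrightarrow> j \<in> Basis \<Longrightarrow> c j = c' j"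
    for c c' j
  proof -
    assume eq: "(\<Sum>j\<in>Basis. scale (c j) j) = (\<Sum>j\<in>Basis. scale (c' j) j)" and j: "j \<in> Basis"
    have "(\<Sum>j\<in>Basis. scale (c j - c' j) j) = 0"
      using eq by (simp add: scale_left_diff_distrib sum_subtractf)
    then have "c j - c' j = 0"
      using independentD[OF independent_Basis finite_Basis subset_refl _ j, of "\<lambda>j. c j - c' j"] by simp
    then show ?thesis by simp
  qed
  have "inj T"
  proof (rule injI)
    fix u v assume "T u = T v"
    then show "u = v" unfolding T_def by (intro eta_eqI) (rule coeff)
  qed
  then have "surj T" using T.linear_axioms by (intro linear_inj_imp_surj)
  then obtain d where d: "T d = i" by (metis surjD)
  have "i = (\<Sum>j\<in>Basis. scale (if i = j then 1 else 0) j)"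
    using that finite_Basis by (simp add: if_distrib[of "\<lambda>c. scale c _"] sum.delta' cong: if_cong)
  with d have "\<eta> d k = (if i = k then 1 else 0)" if "k \<in> Basis" for k
    using that unfolding T_def by (intro coeff[where c = "\<eta> d"]) auto
  then show ?thesis by blast
qed

text \<open>\<open>eta_inv\<close> is a \<open>SOME\<close> choice, so some inverse has to be
  exhibited. The coordinates \<open>c\<close> of the dual vectors form a left inverse of the Gram
  matrix; they are symmetric, because \<open>c i k\<close> equals \<open>\<eta> (d i) (d k)\<close>,
  and symmetry makes the left inverse a right inverse.\<close>

lemma eta_inv_spec:
  "\<forall>i\<in>Basis. \<forall>k\<in>Basis.
     (\<Sum>j\<in>Basis. \<eta> i j * eta_inv j k) = (if i = k then 1 else 0) \<and>
     (\<Sum>j\<in>Basis. eta_inv i j * \<eta> j k) = (if i = k then 1 else 0)"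
proof -
  obtain d where d: "\<And>i k. i \<in> Basis \<Longrightarrow> k \<in> Basis \<Longrightarrow> \<eta> (d i) k = (if i = k then 1 else 0)"
    using ex_dual_vector by metis
  have "\<exists>c. d i = (\<Sum>j\<in>Basis. scale (c j) j)" for i
    using span_Basis by (auto simp: span_finite[OF finite_Basis])
  then obtain c where c: "\<And>i. d i = (\<Sum>j\<in>Basis. scale (c i j) j)" by metis
  have left: "(\<Sum>j\<in>Basis. c i j * \<eta> j k) = (if i = k then 1 else 0)"
    if "i \<in> Basis" "k \<in> Basis" for i k
    using d[OF that] by (simp add: c eta_sum_left eta_scale_left)
  have sym: "c i k = c k i" if "i \<in> Basis" "k \<in> Basis" for i k
  proof -
    have "c i k = \<eta> (d i) (d k)" if "i \<in> Basis" "k \<in> Basis" for i k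
    proof -
      have "\<eta> (d i) (d k) = (\<Sum>j\<in>Basis. c i j * \<eta> (d k) j)"
        by (subst c[of i]) (simp only: eta_sum_left eta_scale_left eta_sym[of "d k"])
      also have "\<dots> = c i k"
        using that finite_Basis by (simp add: d sum.delta' if_distrib[of "\<lambda>x. _ * x"] cong: if_cong)
      finally show ?thesis ..
    qed
    with that show ?thesis by (metis eta_sym)
  qed
  have right: "(\<Sum>j\<in>Basis. \<eta> i j * c j k) = (if i = k then 1 else 0)"
    if "i \<in> Basis" "k \<in> Basis" for i k
    using left[of k i] that by (simp add: sym[of _ k] mult.commute eta_sym[of i] eq_commute cong: if_cong)
  have "\<exists>E. \<forall>i\<in>Basis. \<forall>k\<in>Basis.
     (\<Sum>j\<in>Basis. \<eta> i j * E j k) = (if i = k then 1 else 0) \<and>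
     (\<Sum>j\<in>Basis. E i j * \<eta> j k) = (if i = k then 1 else 0)"
    using left right by blast
  from someI_ex[OF this] show ?thesis unfolding eta_inv_def .
qed

section \<open>The dual basis, the Euler element and the comultiplication\<close>

definition dual :: "'a \<Rightarrow> 'a" where
  "dual k = (\<Sum>a\<in>Basis. scale (eta_inv k a) a)"

lemma eta_dual_right: "\<eta> x (dual k) = (\<Sum>a\<in>Basis. eta_inv k a * \<eta> x a)"
  by (simp add: dual_def eta_sum_right eta_scale_right)

text \<open>Pairing with each basis vector identifies \<open>y\<close> with its expansion whose
  coefficients are \<open>\<eta> y (dual k)\<close>; pairing that expansion with \<open>x\<close>
  gives the claim. It is the rule by which every later sum over the basis is collapsed.\<close>

lemma eta_contract: "(\<Sum>k\<in>Basis. \<eta> x k * \<eta> y (dual k)) = \<eta> x y"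
proof -
  have "y = (\<Sum>k\<in>Basis. scale (\<eta> y (dual k)) k)"
  proof (rule eta_eqI)
    fix l assume l: "l \<in> Basis"
    have "(\<Sum>k\<in>Basis. \<eta> y (dual k) * \<eta> k l) = (\<Sum>k\<in>Basis. \<Sum>a\<in>Basis. \<eta> y a * (\<eta> l k * eta_inv k a))"
      by (simp add: eta_dual_right sum_distrib_left sum_distrib_right mult_ac eta_sym[of l])
    also have "\<dots> = (\<Sum>a\<in>Basis. \<eta> y a * (\<Sum>k\<in>Basis. \<eta> l k * eta_inv k a))"
      by (subst sum.swap) (simp add: sum_distrib_left)
    also have "\<dots> = (\<Sum>a\<in>Basis. if l = a then \<eta> y a else 0)"
      using eta_inv_spec l by (intro sum.cong) auto
    also have "\<dots> = \<eta> y l" using l finite_Basis by (simp add: sum.delta')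
    finally show "\<eta> y l = \<eta> (\<Sum>k\<in>Basis. scale (\<eta> y (dual k)) k) l"
      by (simp add: eta_sum_left eta_scale_left)
  qed
  then have "\<eta> x y = \<eta> x (\<Sum>k\<in>Basis. scale (\<eta> y (dual k)) k)" by simp
  then show ?thesis by (simp add: eta_sum_right eta_scale_right mult.commute)
qed

lemma sum_eta_inv: "(\<Sum>a\<in>Basis. \<Sum>b\<in>Basis. \<eta> x a * \<eta> y b * eta_inv a b) = \<eta> x y"
  unfolding eta_contract[symmetric, of x y] eta_dual_right
  by (simp add: sum_distrib_left mult_ac)

definition euler :: 'a where
  "euler = (\<Sum>k\<in>Basis. k * dual k)"

lemma sum_eta_inv_mult: "(\<Sum>a\<in>Basis. \<Sum>b\<in>Basis. \<eta> x (a * b) * eta_inv a b) = \<eta> x euler"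
  by (simp add: euler_def eta_sum_right eta_mult eta_dual_right mult.commute)

text \<open>Once \<open>f\<close> is linear in each slot, the inner sums over \<open>b\<close> and
  \<open>a\<close> are its values at \<open>dual l\<close> and \<open>dual k\<close>, after which
  \<open>eta_contract\<close> applies to the outer sums.\<close>

lemma on_comult_alt:
  "on_comult v f = (\<Sum>k\<in>Basis. \<Sum>l\<in>Basis. \<eta> v (k * l) *
     (\<Sum>a\<in>Basis. eta_inv k a * (\<Sum>b\<in>Basis. eta_inv l b * f a b)))"
proof -
  let ?t = "\<lambda>a b k l. \<eta> v (k * l) * eta_inv k a * eta_inv l b * f a b"
  have "on_comult v f = (\<Sum>a\<in>Basis. \<Sum>b\<in>Basis. \<Sum>k\<in>Basis. \<Sum>l\<in>Basis. ?t a b k l)"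
    by (simp add: on_comult_def comult_coeff_def sum_distrib_right)
  also have "\<dots> = (\<Sum>a\<in>Basis. \<Sum>k\<in>Basis. \<Sum>b\<in>Basis. \<Sum>l\<in>Basis. ?t a b k l)"
    by (intro sum.cong refl sum.swap)
  also have "\<dots> = (\<Sum>k\<in>Basis. \<Sum>a\<in>Basis. \<Sum>b\<in>Basis. \<Sum>l\<in>Basis. ?t a b k l)"
    by (rule sum.swap)
  also have "\<dots> = (\<Sum>k\<in>Basis. \<Sum>a\<in>Basis. \<Sum>l\<in>Basis. \<Sum>b\<in>Basis. ?t a b k l)"
    by (intro sum.cong refl sum.swap)
  also have "\<dots> = (\<Sum>k\<in>Basis. \<Sum>l\<in>Basis. \<Sum>a\<in>Basis. \<Sum>b\<in>Basis. ?t a b k l)"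
    by (intro sum.cong refl sum.swap)
  finally show ?thesis by (simp add: sum_distrib_left mult_ac)
qed

text \<open>Contracting over \<open>l\<close> leaves the sum over \<open>k\<close> of
  \<open>\<eta> (v * k) (x * dual k)\<close>. Moving the factors across the form collects the
  products \<open>k * dual k\<close> into \<open>euler\<close>.\<close>

lemma on_comult_mult: "on_comult v (\<lambda>a b. \<eta> x (a * b)) = \<eta> x (v * euler)"
proof -
  have "on_comult v (\<lambda>a b. \<eta> x (a * b)) =
      (\<Sum>k\<in>Basis. \<Sum>l\<in>Basis. \<eta> (v * k) l * (\<Sum>a\<in>Basis. eta_inv k a * \<eta> (x * a) (dual l)))"
    by (simp add: on_comult_alt eta_dual_right eta_mult)
  also have "\<dots> = (\<Sum>k\<in>Basis. \<Sum>l\<in>Basis. \<eta> (v * k) l * \<eta> (x * dual k) (dual l))"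
  proof -
    have "(\<Sum>a\<in>Basis. eta_inv k a * \<eta> (x * a) (dual l)) = \<eta> (x * dual k) (dual l)" for k l
      using eta_dual_right[of "x * dual l" k] by (simp add: eta_mult[symmetric] mult_ac) (simp add: eta_mult mult_ac)
    then show ?thesis by simp
  qed
  also have "\<dots> = \<eta> x (v * euler)"
  proof -
    have "\<eta> (v * k) (x * dual k) = \<eta> x (v * (k * dual k))" for k
      by (simp add: counit_mult[symmetric] mult_ac)
    then show ?thesis
      by (simp add: eta_contract euler_def sum_distrib_left eta_sum_right)
  qed
  finally show ?thesis .
qed

text \<open>Two contractions: the one over \<open>l\<close> replaces the second slot by
  \<open>y\<close>, moving \<open>k\<close> across the form prepares the one over \<open>k\<close>,
  and that one inserts \<open>x\<close>.\<close>

lemma on_comult_split: "on_comult v (\<lambda>a b. \<eta> x a * \<eta> y b) = \<eta> v (x * y)"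
proof -
  have "on_comult v (\<lambda>a b. \<eta> x a * \<eta> y b) =
      (\<Sum>k\<in>Basis. \<Sum>l\<in>Basis. \<eta> v (k * l) * (\<eta> x (dual k) * \<eta> y (dual l)))"
  proof -
    have "(\<Sum>a\<in>Basis. eta_inv k a * (\<Sum>b\<in>Basis. eta_inv l b * (\<eta> x a * \<eta> y b))) =
        \<eta> x (dual k) * \<eta> y (dual l)" for k l
      by (simp add: eta_dual_right sum_product) (simp add: sum_distrib_left mult_ac)
    then show ?thesis by (simp add: on_comult_alt)
  qed
  also have "\<dots> = (\<Sum>k\<in>Basis. \<eta> x (dual k) * (\<Sum>l\<in>Basis. \<eta> (v * k) l * \<eta> y (dual l)))"
    by (simp add: sum_distrib_left eta_mult mult_ac)
  also have "\<dots> = (\<Sum>k\<in>Basis. \<eta> (v * y) k * \<eta> x (dual k))"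
  proof -
    have "\<eta> (v * k) y = \<eta> (v * y) k" for k
      by (simp add: counit_mult[symmetric] mult_ac)
    then show ?thesis by (simp add: eta_contract mult.commute[of "\<eta> x _"])
  qed
  also have "\<dots> = \<eta> v (x * y)"
    unfolding eta_contract by (simp add: counit_mult[symmetric] mult_ac)
  finally show ?thesis .
qed

section \<open>The closed formula and its characterization by the TQFT axioms\<close>

definition surface_value :: "nat \<Rightarrow> 'a list \<Rightarrow> 'k" where
  "surface_value g vs = counit (prod_list vs * euler ^ g)"

lemma surface_value_permute:
  assumes "mset us = mset vs"
  shows "surface_value g us = surface_value g vs"
proof -
  have "prod_list us = prod_list vs"
    using arg_cong[OF assms, of prod_mset] by (simp add: prod_mset_prod_list)
  then show ?thesis by (simp add: surface_value_def)
qed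

lemma multilinear_surface_value: "multilinear n (surface_value g)"
  unfolding multilinear_def
proof (intro allI impI)
  fix vs :: "'a list" and i assume "length vs = n" "i < n"
  then have "(\<lambda>x. surface_value g (vs[i := x])) =
      \<eta> (prod_list (take i vs) * prod_list (drop (Suc i) vs) * euler ^ g)"
    by (intro ext) (simp add: surface_value_def upd_conv_take_nth_drop counit_mult[symmetric] mult_ac)
  then show "Vector_Spaces.linear scale (*) (\<lambda>x. surface_value g (vs[i := x]))"
    by (simp add: eta_linear)
qed

lemma sum_surface_value_handle:
  "(\<Sum>a\<in>Basis. \<Sum>b\<in>Basis. surface_value g (vs @ [a, b]) * eta_inv a b) = surface_value (Suc g) vs"
proof -
  have "surface_value g (vs @ [a, b]) = \<eta> (prod_list vs * euler ^ g) (a * b)" for a b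
    by (simp add: surface_value_def counit_mult[symmetric] mult_ac)
  then show ?thesis
    by (simp add: sum_eta_inv_mult) (simp add: surface_value_def counit_mult[symmetric] mult_ac)
qed

lemma sum_surface_value_glue:
  "(\<Sum>a\<in>Basis. \<Sum>b\<in>Basis. surface_value g1 (us @ [a]) * surface_value g2 (ws @ [b]) * eta_inv a b) =
     surface_value (g1 + g2) (us @ ws)"
proof -
  have "surface_value g (us @ [a]) = \<eta> (prod_list us * euler ^ g) a" for g us a
    by (simp add: surface_value_def counit_mult[symmetric] mult_ac)
  then show ?thesis
    by (simp add: sum_eta_inv) (simp add: surface_value_def counit_mult[symmetric] power_add mult_ac)
qed

text \<open>By commutativity all arguments except the split one, together with the power of
  \<open>euler\<close>, form a fixed factor. The comultiplied slots then occur only through their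
  product, so \<open>on_comult_mult\<close> supplies the extra \<open>euler\<close>.\<close>

lemma on_comult_surface_value:
  assumes "i < length vs"
  shows "on_comult (vs ! i) (\<lambda>a b. surface_value g (split_slot i vs a b)) = surface_value (Suc g) vs"
proof -
  let ?r = "prod_list (take i vs) * prod_list (drop (Suc i) vs)"
  have vs: "prod_list vs = vs ! i * ?r"
    by (subst id_take_nth_drop[OF assms]) (simp add: mult_ac)
  have "surface_value g (split_slot i vs a b) = \<eta> (?r * euler ^ g) (a * b)" for a b
    by (simp add: surface_value_def split_slot_def counit_mult[symmetric] mult_ac)
  then show ?thesis
    by (simp add: on_comult_mult) (simp add: surface_value_def counit_mult[symmetric] vs mult_ac)
qed

text \<open>Agreement is assumed only on lists of the right length, since an induced family is
  determined only there.\<close>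

lemma surface_value_is_TQFT:
  assumes eq: "\<And>g n vs. n \<ge> 1 \<Longrightarrow> length vs = n \<Longrightarrow> \<omega> g n vs = surface_value g vs"
  shows "is_TQFT \<omega>"
  unfolding is_TQFT_def
proof (intro conjI allI impI)
  fix g n :: nat assume "n \<ge> 1"
  then have "\<forall>vs i x. length vs = n \<longrightarrow> i < n \<longrightarrow> \<omega> g n (vs[i := x]) = surface_value g (vs[i := x])"
    by (simp add: eq)
  then show "multilinear n (\<omega> g n)"
    using multilinear_surface_value[of n g] by (simp add: multilinear_def)
next
  fix v show "\<omega> 0 1 [v] = counit v" by (simp add: eq surface_value_def)
next
  fix v1 v2 show "\<omega> 0 2 [v1, v2] = \<eta> v1 v2"
    by (simp add: eq surface_value_def counit_mult)
next
  fix v1 v2 v3 show "\<omega> 0 3 [v1, v2, v3] = counit (v1 * v2 * v3)"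
    by (simp add: eq surface_value_def mult.assoc)
next
  fix g n :: nat and p and vs :: "'a list" assume "n \<ge> 1" "length vs = n" "p permutes {..<n}"
  then show "\<omega> g n (permute_list p vs) = \<omega> g n vs"
    by (simp add: eq surface_value_permute[of "permute_list p vs" vs])
next
  fix g n :: nat and vs :: "'a list" assume "n \<ge> 1" "length vs = n"
  then show "\<omega> g (n + 1) (vs @ [1]) = \<omega> g n vs"
    by (simp add: eq) (simp add: surface_value_def)
next
  fix g n :: nat and vs :: "'a list" assume "g \<ge> 1" "n \<ge> 1" "length vs = n"
  then show "\<omega> g n vs = (\<Sum>a\<in>Basis. \<Sum>b\<in>Basis. \<omega> (g - 1) (n + 2) (vs @ [a, b]) * eta_inv a b)"
    by (simp add: eq sum_surface_value_handle)
next
  fix g1 g2 :: nat and us ws :: "'a list" assume "length us + length ws \<ge> 1"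
  then show "\<omega> (g1 + g2) (length us + length ws) (us @ ws) =
      (\<Sum>a\<in>Basis. \<Sum>b\<in>Basis.
         \<omega> g1 (length us + 1) (us @ [a]) * \<omega> g2 (length ws + 1) (ws @ [b]) * eta_inv a b)"
    by (simp add: eq sum_surface_value_glue)
qed

lemma TQFT_glue:
  assumes "is_TQFT \<omega>" "length us + length ws \<ge> 1"
  shows "\<omega> (g1 + g2) (length us + length ws) (us @ ws) =
      (\<Sum>a\<in>Basis. \<Sum>b\<in>Basis.
         \<omega> g1 (length us + 1) (us @ [a]) * \<omega> g2 (length ws + 1) (ws @ [b]) * eta_inv a b)"
  using assms unfolding is_TQFT_def by blast

lemma TQFT_handle:
  assumes "is_TQFT \<omega>" "length vs \<ge> 1"
  shows "\<omega> (Suc g) (length vs) vs =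
      (\<Sum>a\<in>Basis. \<Sum>b\<in>Basis. \<omega> g (length vs + 2) (vs @ [a, b]) * eta_inv a b)"
proof -
  have "\<forall>g n vs. g \<ge> 1 \<longrightarrow> n \<ge> 1 \<longrightarrow> length vs = n \<longrightarrow>
        \<omega> g n vs = (\<Sum>a\<in>Basis. \<Sum>b\<in>Basis. \<omega> (g - 1) (n + 2) (vs @ [a, b]) * eta_inv a b)"
    using assms(1) unfolding is_TQFT_def by blast
  from this[rule_format, of "Suc g" "length vs" vs] assms(2) show ?thesis by simp
qed

text \<open>In genus 0 a pair of pants is split off to lower the number of inputs to the prescribed
  cases; each further genus is removed by the handle axiom. That axiom adds two inputs, so
  \<open>n\<close> stays arbitrary in the induction on \<open>g\<close>.\<close>

lemma TQFT_unique:
  assumes \<omega>: "is_TQFT \<omega>" and "n \<ge> 1" "length vs = n"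
  shows "\<omega> g n vs = surface_value g vs"
  using assms(2,3)
proof (induction g arbitrary: n vs)
  case 0
  then show ?case
  proof (induction n arbitrary: vs rule: less_induct)
    case (less n)
    have small: "\<omega> 0 1 [v] = counit v" "\<omega> 0 2 [v, v'] = \<eta> v v'"
        "\<omega> 0 3 [v, v', v''] = counit (v * v' * v'')" for v v' v''
      using \<omega> by (auto simp: is_TQFT_def)
    consider v where "vs = [v]" | v v' where "vs = [v, v']" | v v' v'' where "vs = [v, v', v'']"
      | v v' v'' w ws where "vs = v # v' # v'' # w # ws"
      using less.prems by (cases vs; cases "tl vs"; cases "tl (tl vs)"; cases "tl (tl (tl vs))") auto
    then show ?case
    proof cases
      case 1 with less.prems small show ?thesis by (simp add: surface_value_def)
    next
      case 2
      with less.prems small(2)[of v v'] show ?thesis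
        by (simp add: surface_value_def counit_mult numeral_2_eq_2)
    next
      case 3
      with less.prems small(3)[of v v' v''] show ?thesis
        by (simp add: surface_value_def numeral_3_eq_3 mult.assoc)
    next
      case 4
      \<comment> \<open>Two inputs and the glued one make the first piece a prescribed three-holed
        sphere; the second piece has n - 1 inputs, so the induction hypothesis applies to
        it.\<close>
      let ?us = "[v, v']" and ?ws = "v'' # w # ws"
      have "\<omega> (0 + 0) (length ?us + length ?ws) (?us @ ?ws) =
          (\<Sum>a\<in>Basis. \<Sum>b\<in>Basis. \<omega> 0 (length ?us + 1) (?us @ [a]) *
             \<omega> 0 (length ?ws + 1) (?ws @ [b]) * eta_inv a b)"
        by (rule TQFT_glue[OF \<omega>]) simp
      also have "\<dots> = (\<Sum>a\<in>Basis. \<Sum>b\<in>Basis. surface_value 0 (?us @ [a]) *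
             surface_value 0 (?ws @ [b]) * eta_inv a b)"
      proof -
        have "\<omega> 0 (length ?us + 1) (?us @ [a]) = surface_value 0 (?us @ [a])" for a
          using small(3)[of v v' a] by (simp add: surface_value_def numeral_3_eq_3 mult.assoc)
        moreover have "\<omega> 0 (length ?ws + 1) (?ws @ [b]) = surface_value 0 (?ws @ [b])" for b
          using 4 less.prems by (intro less.IH) auto
        ultimately show ?thesis by simp
      qed
      also have "\<dots> = surface_value (0 + 0) (?us @ ?ws)" by (rule sum_surface_value_glue)
      finally show ?thesis using 4 less.prems by simp
    qed
  qed
next
  case (Suc g)
  have "\<omega> (Suc g) n vs = (\<Sum>a\<in>Basis. \<Sum>b\<in>Basis. \<omega> g (n + 2) (vs @ [a, b]) * eta_inv a b)"
    using TQFT_handle[OF \<omega>, of vs g] Suc.prems by simp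
  also have "\<dots> = (\<Sum>a\<in>Basis. \<Sum>b\<in>Basis. surface_value g (vs @ [a, b]) * eta_inv a b)"
    using Suc.prems by (simp add: Suc.IH)
  finally show ?case by (simp add: sum_surface_value_handle)
qed

end

section \<open>Edge-contraction axioms\<close>

lemma prod_list_nths_partition:
  fixes xs :: "'a::comm_monoid_mult list"
  assumes "\<And>k. k < length xs \<Longrightarrow> (k \<in> S1) \<noteq> (k \<in> S2)"
  shows "prod_list (nths xs S1) * prod_list (nths xs S2) = prod_list xs"
  using arg_cong[where f = prod_mset, OF mset_nths_partition[of xs S1 S2, OF assms]] by (simp add: prod_mset_prod_list)

lemma prod_list_merge:
  fixes xs :: "'a::comm_monoid_mult list"
  assumes "i < j" "j < length xs"
  shows "prod_list (remove_nth j (xs[i := xs ! i * xs ! j])) = prod_list xs"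
proof -
  obtain A B D where xs: "xs = A @ xs ! i # B @ xs ! j # D" and len: "length A = i" "length B = j - Suc i"
    using split_at_two[OF assms] .
  have "prod_list (remove_nth j ((A @ x # B @ y # D)[i := x * y])) = prod_list (A @ x # B @ y # D)" for x y
  proof -
    have j: "j = length A + Suc (length B)" using assms(1) len by simp
    show ?thesis
      unfolding j len(1)[symmetric] by (simp add: remove_nth_def list_update_append mult_ac)
  qed
  then show ?thesis using xs by metis
qed

text \<open>Each factor is linear in its own new slot, with a coefficient made of the old arguments
  on its side and a power of \<open>euler\<close>. By \<open>on_comult_split\<close> the
  coefficients multiply, and the partition reassembles all old arguments except the split one. The
  bound \<open>k \<le> length vs\<close> reflects that the split list is one entry longer than
  \<open>vs\<close>.\<close>

lemma (in frobenius_algebra) on_comult_surface_value_components: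
  assumes i: "i < length vs" and part: "\<And>k. k \<le> length vs \<Longrightarrow> (k \<in> S1) \<noteq> (k \<in> S2)"
    and "i \<in> S1" "Suc i \<in> S2"
  shows "on_comult (vs ! i) (\<lambda>a b. surface_value g1 (nths (split_slot i vs a b) S1) *
      surface_value g2 (nths (split_slot i vs a b) S2)) = surface_value (g1 + g2) vs"
proof -
  define A D where "A = take i vs" and "D = drop (Suc i) vs"
  have vs: "vs = A @ vs ! i # D" unfolding A_def D_def by (rule id_take_nth_drop[OF i])
  have len: "length A = i" "length vs = Suc (i + length D)" using i by (simp_all add: A_def D_def)
  \<comment> \<open>Entry \<open>k\<close> of \<open>D\<close> stands at position
    \<open>k + i + 2\<close> of the split list, after the \<open>i\<close> entries of
    \<open>A\<close> and the two new slots.\<close>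
  let ?T = "\<lambda>S. {k. Suc (Suc (k + i)) \<in> S}"
  define P where "P S = prod_list (nths A S) * prod_list (nths D (?T S))" for S
  have not: "Suc i \<notin> S1" "i \<notin> S2" using assms part[of i] part[of "Suc i"] by auto
  have "prod_list (nths A S1) * prod_list (nths A S2) = prod_list A"
    "prod_list (nths D (?T S1)) * prod_list (nths D (?T S2)) = prod_list D"
    using part len by (intro prod_list_nths_partition; simp)+
  moreover have "P S1 * P S2 = (prod_list (nths A S1) * prod_list (nths A S2)) *
      (prod_list (nths D (?T S1)) * prod_list (nths D (?T S2)))"
    by (simp add: P_def mult_ac)
  ultimately have PP: "P S1 * P S2 = prod_list A * prod_list D" by simp
  have "nths (split_slot i vs a b) S1 = nths A S1 @ [a] @ nths D (?T S1)"
    "nths (split_slot i vs a b) S2 = nths A S2 @ [b] @ nths D (?T S2)" for a b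
    using assms(3,4) not len(1) by (simp_all add: split_slot_def nths_append nths_Cons flip: A_def D_def)
  then have "surface_value g1 (nths (split_slot i vs a b) S1) = \<eta> (P S1 * euler ^ g1) a"
    "surface_value g2 (nths (split_slot i vs a b) S2) = \<eta> (P S2 * euler ^ g2) b" for a b
    by (simp_all add: surface_value_def counit_mult[symmetric] P_def mult_ac)
  then have "on_comult (vs ! i) (\<lambda>a b. surface_value g1 (nths (split_slot i vs a b) S1) *
      surface_value g2 (nths (split_slot i vs a b) S2)) =
      \<eta> (vs ! i) ((P S1 * P S2) * (euler ^ g1 * euler ^ g2))"
    by (simp add: on_comult_split mult_ac)
  also have "\<dots> = counit (prod_list (A @ vs ! i # D) * (euler ^ g1 * euler ^ g2))"
    unfolding PP by (simp add: counit_mult[symmetric] mult_ac)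
  also have "\<dots> = surface_value (g1 + g2) vs"
    unfolding surface_value_def vs[symmetric] power_add ..
  finally show ?thesis .
qed

context frobenius_algebra
begin

lemma on_comult_cong:
  "(\<And>a b. f a b = f' a b) \<Longrightarrow> on_comult v f = on_comult v f'"
  by (simp add: on_comult_def)

text \<open>The value of \<open>\<Omega>\<close> is assumed on the two components alone. Thus the
  lemma fits both the induction hypotheses for an arbitrary solution of the axioms and the
  verification that the closed formula is a solution.\<close>

lemma loop_components_surface_value:
  assumes \<gamma>: "\<gamma> \<in> cell_graphs g n" and contracts: "contracts_loop \<gamma> i \<gamma>'"
    and disc: "\<not> connected_graph \<gamma>'" and vs: "length vs = n"
    and \<Omega>: "\<And>k g vs. subgraph_on \<gamma>' (component_of \<gamma>' k) \<in> cell_graphs g (length vs) \<Longrightarrow>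
      k = i \<or> k = Suc i \<Longrightarrow> \<Omega> (subgraph_on \<gamma>' (component_of \<gamma>' k)) vs = surface_value g vs"
  shows "on_comult (vs ! i) (\<lambda>a b.
      \<Omega> (subgraph_on \<gamma>' (component_of \<gamma>' i)) (nths (split_slot i vs a b) (component_of \<gamma>' i)) *
      \<Omega> (subgraph_on \<gamma>' (component_of \<gamma>' (Suc i)))
        (nths (split_slot i vs a b) (component_of \<gamma>' (Suc i)))) = surface_value g vs"
proof -
  let ?S1 = "component_of \<gamma>' i" and ?S2 = "component_of \<gamma>' (Suc i)"
  have wf: "wf_graph \<gamma>" and conn: "connected_graph \<gamma>" and n: "num_vertices \<gamma> = n"
    using \<gamma> by (auto simp: cell_graphs_iff)
  note e = euler_char_contracts_loop[OF wf contracts]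
  note comp = contracts_loop_components[OF wf conn contracts disc]
  obtain g1 g2 where g: "g = g1 + g2" and g12: "subgraph_on \<gamma>' ?S1 \<in> cell_graphs g1 (card ?S1)"
      "subgraph_on \<gamma>' ?S2 \<in> cell_graphs g2 (card ?S2)"
    using contracts_loop_disconnected_cell_graphs[OF \<gamma> contracts disc] by metis
  have i: "i < length vs" using e(4) n vs by simp
  have len: "length (nths (split_slot i vs a b) (component_of \<gamma>' k)) = card (component_of \<gamma>' k)" for a b k
  proof -
    have "length (split_slot i vs a b) = num_vertices \<gamma>'" using i vs n e(3) by (simp add: split_slot_def)
    then have "{m. m < length (split_slot i vs a b) \<and> m \<in> component_of \<gamma>' k} = component_of \<gamma>' k"
      by (auto simp: component_of_def)
    then show ?thesis by (simp add: length_nths)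
  qed
  have part: "(k \<in> ?S1) \<noteq> (k \<in> ?S2)" if "k \<le> length vs" for k
  proof -
    have "k \<in> ?S1 \<union> ?S2" unfolding comp(1) using that vs n e(3) by simp
    with comp(2) show ?thesis by blast
  qed
  have "\<Omega> (subgraph_on \<gamma>' ?S1) (nths (split_slot i vs a b) ?S1) =
      surface_value g1 (nths (split_slot i vs a b) ?S1)"
    "\<Omega> (subgraph_on \<gamma>' ?S2) (nths (split_slot i vs a b) ?S2) =
      surface_value g2 (nths (split_slot i vs a b) ?S2)" for a b
    using g12 by (intro \<Omega>; simp add: len)+
  then show ?thesis using on_comult_surface_value_components[OF i part comp(3,4)] by (simp add: g)
qed

text \<open>Genus and arguments are quantified inside the property proved by induction, because a
  contraction changes both.\<close>

lemma ECA_value: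
  assumes \<Omega>: "satisfies_ECA \<Omega>"
    and "wf_graph \<gamma>" "connected_graph \<gamma>" "num_vertices \<gamma> \<ge> 1"
  shows "\<forall>g vs. \<gamma> \<in> cell_graphs g (length vs) \<longrightarrow> \<Omega> \<gamma> vs = surface_value g vs"
  using assms(2-4)
proof (induction rule: connected_graph_induct)
  case point
  show ?case
  proof (intro allI impI)
    fix g and vs :: "'a list" assume \<gamma>: "point_graph \<in> cell_graphs g (length vs)"
    then have "g = 0" "length vs = 1"
      using euler_char_point by (auto simp: cell_graphs_iff num_vertices_def point_graph_def)
    then obtain v where "vs = [v]" by (auto simp: length_Suc_conv)
    then show "\<Omega> point_graph vs = surface_value g vs"
      using \<Omega> \<open>g = 0\<close> by (simp add: satisfies_ECA_def ECA0_def surface_value_def)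
  qed
next
  case (edge \<gamma> i j \<gamma>')
  show ?case
  proof (intro allI impI)
    fix g and vs :: "'a list" assume \<gamma>: "\<gamma> \<in> cell_graphs g (length vs)"
    let ?ws = "remove_nth j (vs[i := vs ! i * vs ! j])"
    have ij: "i < j" "j < length vs"
      using edge(3) \<gamma> by (auto simp: contracts_edge_def cell_graphs_iff)
    have "ECA1 \<Omega>" using \<Omega> by (simp add: satisfies_ECA_def)
    then have "\<Omega> \<gamma> vs = \<Omega> \<gamma>' ?ws" using \<gamma> edge(3) unfolding ECA1_def by blast
    also have "\<gamma>' \<in> cell_graphs g (length ?ws)"
      using contracts_edge_cell_graphs[OF \<gamma> edge(3)] ij by (simp add: length_remove_nth)
    then have "\<Omega> \<gamma>' ?ws = surface_value g ?ws" using edge(4) by blast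
    also have "\<dots> = surface_value g vs" using prod_list_merge[OF ij] by (simp add: surface_value_def)
    finally show "\<Omega> \<gamma> vs = surface_value g vs" .
  qed
next
  case (loop_connected \<gamma> i \<gamma>')
  show ?case
  proof (intro allI impI)
    fix g and vs :: "'a list" assume \<gamma>: "\<gamma> \<in> cell_graphs g (length vs)"
    have i: "i < length vs" using loop_connected(3) \<gamma> by (auto simp: contracts_loop_def cell_graphs_iff)
    obtain g' where g': "g = Suc g'" "\<gamma>' \<in> cell_graphs g' (Suc (length vs))"
      using contracts_loop_cell_graphs[OF \<gamma> loop_connected(3,4)] .
    have "ECA2 \<Omega>" using \<Omega> by (simp add: satisfies_ECA_def)
    then have "\<Omega> \<gamma> vs = on_comult (vs ! i) (\<lambda>a b. \<Omega> \<gamma>' (split_slot i vs a b))"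
      using \<gamma> loop_connected(3,4) unfolding ECA2_def by blast
    also have "\<dots> = on_comult (vs ! i) (\<lambda>a b. surface_value g' (split_slot i vs a b))"
    proof (rule on_comult_cong)
      fix a b
      have "length (split_slot i vs a b) = Suc (length vs)" using i by (simp add: split_slot_def)
      then show "\<Omega> \<gamma>' (split_slot i vs a b) = surface_value g' (split_slot i vs a b)"
        using g'(2) loop_connected(5) by simp
    qed
    finally show "\<Omega> \<gamma> vs = surface_value g vs" using on_comult_surface_value[OF i] g'(1) by simp
  qed
next
  case (loop_disconnected \<gamma> i \<gamma>')
  show ?case
  proof (intro allI impI)
    fix g and vs :: "'a list" assume \<gamma>: "\<gamma> \<in> cell_graphs g (length vs)"
    have "ECA2 \<Omega>" using \<Omega> by (simp add: satisfies_ECA_def)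
    then have "\<Omega> \<gamma> vs = on_comult (vs ! i) (\<lambda>a b.
        \<Omega> (subgraph_on \<gamma>' (component_of \<gamma>' i)) (nths (split_slot i vs a b) (component_of \<gamma>' i)) *
        \<Omega> (subgraph_on \<gamma>' (component_of \<gamma>' (i + 1)))
          (nths (split_slot i vs a b) (component_of \<gamma>' (i + 1))))"
      using \<gamma> loop_disconnected(3,4) unfolding ECA2_def Let_def by blast
    also have "\<dots> = surface_value g vs"
      unfolding Suc_eq_plus1[symmetric]
      using loop_disconnected(5,6)
      by (intro loop_components_surface_value[OF \<gamma> loop_disconnected(3,4) refl]) auto
    finally show "\<Omega> \<gamma> vs = surface_value g vs" .
  qed
qed

text \<open>Isomorphism invariance is immediate, since graphs of the same type have the same genus;
  the remaining axioms are the product and comultiplication identities above, read from the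
  contracted graph back to the original.\<close>

lemma satisfies_ECA_surface_value: "satisfies_ECA (\<lambda>\<gamma>. surface_value (genus \<gamma>))"
  unfolding satisfies_ECA_def
proof (intro conjI)
  show "graph_assignment (\<lambda>\<gamma>. surface_value (genus \<gamma>))"
    by (auto simp: graph_assignment_def multilinear_surface_value genus_eq)
  show "ECA0 (\<lambda>\<gamma>. surface_value (genus \<gamma>))"
    using genus_eq[OF point_graph_in_cell_graphs] by (simp add: ECA0_def surface_value_def)
  show "ECA1 (\<lambda>\<gamma>. surface_value (genus \<gamma>))"
    unfolding ECA1_def
  proof (intro allI ballI impI)
    fix g n \<gamma> i j \<gamma>' and vs :: "'a list"
    assume \<gamma>: "\<gamma> \<in> cell_graphs g n" and contracts: "contracts_edge \<gamma> i j \<gamma>'" and vs: "length vs = n"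
    have "i < j" "j < length vs" using contracts \<gamma> vs by (auto simp: contracts_edge_def cell_graphs_iff)
    then have "prod_list (remove_nth j (vs[i := vs ! i * vs ! j])) = prod_list vs" by (rule prod_list_merge)
    then show "surface_value (genus \<gamma>) vs =
        surface_value (genus \<gamma>') (remove_nth j (vs[i := vs ! i * vs ! j]))"
      using genus_eq[OF \<gamma>] genus_eq[OF contracts_edge_cell_graphs[OF \<gamma> contracts]]
      by (simp add: surface_value_def)
  qed
  show "ECA2 (\<lambda>\<gamma>. surface_value (genus \<gamma>))"
    unfolding ECA2_def Let_def Suc_eq_plus1[symmetric]
  proof (intro allI ballI impI conjI)
    fix g n \<gamma> i \<gamma>' and vs :: "'a list"
    assume \<gamma>: "\<gamma> \<in> cell_graphs g n" and contracts: "contracts_loop \<gamma> i \<gamma>'" and vs: "length vs = n"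
    have i: "i < length vs" using contracts \<gamma> vs by (auto simp: contracts_loop_def cell_graphs_iff)
    show "surface_value (genus \<gamma>) vs =
        on_comult (vs ! i) (\<lambda>a b. surface_value (genus \<gamma>') (split_slot i vs a b))"
      if conn: "connected_graph \<gamma>'"
    proof -
      obtain g' where "g = Suc g'" "\<gamma>' \<in> cell_graphs g' (Suc n)"
        using contracts_loop_cell_graphs[OF \<gamma> contracts conn] .
      then show ?thesis using on_comult_surface_value[OF i] genus_eq \<gamma> by metis
    qed
    show "surface_value (genus \<gamma>) vs = on_comult (vs ! i) (\<lambda>a b.
        surface_value (genus (subgraph_on \<gamma>' (component_of \<gamma>' i)))
          (nths (split_slot i vs a b) (component_of \<gamma>' i)) *
        surface_value (genus (subgraph_on \<gamma>' (component_of \<gamma>' (Suc i))))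
          (nths (split_slot i vs a b) (component_of \<gamma>' (Suc i))))"
      if disc: "\<not> connected_graph \<gamma>'"
      unfolding genus_eq[OF \<gamma>]
      by (rule loop_components_surface_value[OF \<gamma> contracts disc vs, symmetric]) (simp add: genus_eq)
  qed
qed

lemma satisfies_ECA_eq:
  assumes "satisfies_ECA \<Omega>" "\<gamma> \<in> cell_graphs g n" "length vs = n"
  shows "\<Omega> \<gamma> vs = surface_value g vs"
  using ECA_value[OF assms(1), of \<gamma>] assms(2,3) by (auto simp: cell_graphs_iff)

lemma induced_family_eq:
  assumes "satisfies_ECA \<Omega>" "n \<ge> 1" "length vs = n"
  shows "induced_family \<Omega> g n vs = surface_value g vs"
  unfolding induced_family_def
proof (rule satisfies_ECA_eq[OF assms(1) _ assms(3)])
  show "(SOME \<gamma>. \<gamma> \<in> cell_graphs g n) \<in> cell_graphs g n"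
    using cell_graphs_nonempty[OF assms(2), of g] by (simp add: some_in_eq)
qed

end

theorem corollary4p8:
  fixes scale :: "'k::field \<Rightarrow> 'a::{comm_ring, comm_monoid_mult} \<Rightarrow> 'a"
    and Basis :: "'a set"
    and \<eta> :: "'a \<Rightarrow> 'a \<Rightarrow> 'k"
  assumes "frobenius_algebra scale Basis \<eta>"
  shows
    "(\<forall>g n. n \<ge> 1 \<longrightarrow> cell_graphs g n \<noteq> {}) \<and>
     (\<forall>\<Omega>. frobenius_algebra.satisfies_ECA scale Basis \<eta> \<Omega> \<longrightarrow>
        (\<forall>g n. \<forall>\<gamma>\<in>cell_graphs g n. \<forall>vs. length vs = n \<longrightarrow> \<Omega> \<gamma> vs = induced_family \<Omega> g n vs) \<and>
        frobenius_algebra.is_TQFT scale Basis \<eta> (induced_family \<Omega>)) \<and>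
     (\<forall>\<omega>. frobenius_algebra.is_TQFT scale Basis \<eta> \<omega> \<longrightarrow>
        (\<exists>\<Omega>. frobenius_algebra.satisfies_ECA scale Basis \<eta> \<Omega> \<and>
          (\<forall>g n vs. n \<ge> 1 \<longrightarrow> length vs = n \<longrightarrow> induced_family \<Omega> g n vs = \<omega> g n vs)))"
proof -
  interpret frobenius_algebra scale Basis \<eta> by (rule assms)
  show ?thesis
  proof (intro conjI allI impI ballI)
    fix g n :: nat assume "n \<ge> 1"
    then show "cell_graphs g n \<noteq> {}" by (rule cell_graphs_nonempty)
  next
    fix \<Omega> g n \<gamma> and vs :: "'a list"
    assume \<Omega>: "satisfies_ECA \<Omega>" and \<gamma>: "\<gamma> \<in> cell_graphs g n" and vs: "length vs = n"
    have "n \<ge> 1" using \<gamma> by (simp add: cell_graphs_iff)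
    then show "\<Omega> \<gamma> vs = induced_family \<Omega> g n vs"
      using induced_family_eq[OF \<Omega> _ vs] satisfies_ECA_eq[OF \<Omega> \<gamma> vs] by simp
  next
    fix \<Omega> assume "satisfies_ECA \<Omega>"
    then show "is_TQFT (induced_family \<Omega>)" by (intro surface_value_is_TQFT induced_family_eq)
  next
    fix \<omega> assume \<omega>: "is_TQFT \<omega>"
    \<comment> \<open>One assignment serves every \<open>\<omega>\<close>: by uniqueness any TQFT on
      this algebra has the values of the closed formula.\<close>
    show "\<exists>\<Omega>. satisfies_ECA \<Omega> \<and>
        (\<forall>g n vs. n \<ge> 1 \<longrightarrow> length vs = n \<longrightarrow> induced_family \<Omega> g n vs = \<omega> g n vs)"
      using satisfies_ECA_surface_value induced_family_eq[OF satisfies_ECA_surface_value]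
        TQFT_unique[OF \<omega>] by (intro exI[of _ "\<lambda>\<gamma>. surface_value (genus \<gamma>)"]) simp
  qed
qed

end
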